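(* Let $d\ge 2$ and let $H$ be a primitive substitution on a finite collection of polygonal basic tiles $\{T_1,\ldots,T_n\}$ in $\mathbb{R}^d$, with substitution tiling space $X_H$. Then: (a) If $\tau\in X_H$, $h$ is a choice function on $\{T_1,\dots,T_n\}$, and $Y$ is a Delone set obtained from $\tau$ by picking the point prescribed by $h$ in each tile of $\tau$, then $Y$ is not a Danzer set. (b) For every $\tau\in X_H$, the set of vertices of the tiles of $\tau$ is not a Danzer set.
   Context: A set $Y\subseteq\mathbb{R}^d$ is a Danzer set if it intersects every convex subset of $\mathbb{R}^d$ of volume $1$. A Delone set is a set $Y\subseteq\mathbb{R}^d$ with $\inf_{x,y\in Y,\,x\ne y}\|x-y\|>0$ and $\sup_{x\in\mathbb{R}^d}\inf_{y\in Y}\|x-y\|<\infty$. A tiling of a set is a countable collection of tiles, each the closure of its interior, which intersect only in their boundaries and whose union is the set. Tiles are polygonal if they are $d$-dimensional polytopes, i.e. convex bounded sets obtained as intersections of finitely many half-spaces. Given a finite collection of tiles $\mathcal{F}=\{T_1,\ldots,T_n\}$ in $\mathbb{R}^d$, a substitution is a map $H$ that assigns to every $T_i$ a finite tiling of the set $T_i$ by isometric copies of $\zeta T_1,\ldots,\zeta T_n$, where $\zeta\in(0,1)$ is fixed and independent of $i$. $H$ extends in the obvious way to finite unions of isometric copies of the $T_i$. Put $\xi=\zeta^{-1}$; applying $H$ and then rescaling by $\xi$ (denoted $\xi H$) turns a patch of isometric copies of the $T_i$ into a larger patch of isometric copies of the $T_i$. Let $\mathcal{P}=\{(\xi H)^m(T_i):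 m\in\mathbb{N},\ 1\le i\le n\}$. The substitution tiling space $X_H$ is the set of tilings $\tau$ of $\mathbb{R}^d$ by isometric copies of the $T_i$ such that for every compact $K\subseteq\mathbb{R}^d$ there is $P\in\mathcal{P}$ such that the patch $\{\text{tiles } T \text{ of } \tau : T\subseteq K\}$ is, up to an isometry of $\mathbb{R}^d$, a sub-patch of $P$. The substitution matrix is $A_H=(a_{ij})$, where $a_{ij}$ is the number of isometric copies of $\zeta T_i$ in $H(T_j)$. $H$ is primitive if $A_H^m$ has strictly positive entries for some $m\in\mathbb{N}$. A choice function is a function $h$ assigning to each $T_i$ a point $h(T_i)\in T_i$. Each tile of $\tau$ is of the form $g(T_i)$ for some $i$ and some isometry $g$ of $\mathbb{R}^d$; the point prescribed by $h$ in that tile is $g(h(T_i))$. *)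

theory Defs
  imports "HOL-Analysis.Analysis"
begin

definition danzer_set :: "'a::euclidean_space set \<Rightarrow> bool" where
  "danzer_set Y \<longleftrightarrow> (\<forall>C. convex C \<and> emeasure lebesgue C = 1 \<longrightarrow> Y \<inter> C \<noteq> {})"

text \<open>The infima are taken in \<open>ennreal\<close>, so that an infimum over the empty set is infinite.\<close>

definition delone_set :: "'a::euclidean_space set \<Rightarrow> bool" where
  "delone_set Y \<longleftrightarrow>
     (INF x\<in>Y. INF y\<in>Y - {x}. ennreal (norm (x - y))) > 0 \<and>
     (SUP x. INF y\<in>Y. ennreal (norm (x - y))) < \<infinity>"

text \<open>In Euclidean space a distance preserving self-map is automatically surjective.\<close>

definition isometry :: "('a::euclidean_space \<Rightarrow> 'a) \<Rightarrow> bool" where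
  "isometry g \<longleftrightarrow> (\<forall>x y. dist (g x) (g y) = dist x y)"

definition tiling :: "'a::euclidean_space set set \<Rightarrow> 'a set \<Rightarrow> bool" where
  "tiling \<tau> A \<longleftrightarrow>
     countable \<tau> \<and>
     (\<forall>S\<in>\<tau>. closure (interior S) = S) \<and>
     (\<forall>S\<in>\<tau>. \<forall>S'\<in>\<tau>. S \<noteq> S' \<longrightarrow> S \<inter> S' \<subseteq> frontier S \<inter> frontier S') \<and>
     \<Union>\<tau> = A"

definition polygonal_tile :: "'a::euclidean_space set \<Rightarrow> bool" where
  "polygonal_tile S \<longleftrightarrow> polytope S \<and> aff_dim S = int DIM('a)"

text \<open>
  The basic tiles are a family \<open>T\<close> over a finite index type \<open>'n\<close>. A pair \<open>(i, g)\<close>, with \<open>g\<close> an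
  isometry, is the copy \<open>g ` T i\<close> (in the image of a substitution, \<open>g ` (\<zeta> T i)\<close>) together with
  the way it is obtained from a basic tile. Keeping the pair makes the extension of a
  substitution to copies of the basic tiles well defined also when some \<open>T i\<close> has a nontrivial
  symmetry or two basic tiles are congruent.
\<close>

type_synonym ('n, 'a) copy = "'n \<times> ('a \<Rightarrow> 'a)"

definition tile_of :: "('n \<Rightarrow> 'a set) \<Rightarrow> ('n, 'a) copy \<Rightarrow> 'a set" where
  "tile_of T = (\<lambda>(i, g). g ` T i)"

definition scaled_tiles :: "real \<Rightarrow> ('n \<Rightarrow> 'a::euclidean_space set) \<Rightarrow> 'n \<Rightarrow> 'a set" where
  "scaled_tiles \<zeta> T i = (*\<^sub>R) \<zeta> ` T i"

text \<open>The injectivity condition says that no tile of \<open>H i\<close> is listed by two different pairs.\<close>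

definition substitution ::
  "('n::finite \<Rightarrow> 'a::euclidean_space set) \<Rightarrow> real \<Rightarrow> ('n \<Rightarrow> ('n, 'a) copy set) \<Rightarrow> bool" where
  "substitution T \<zeta> H \<longleftrightarrow>
     0 < \<zeta> \<and> \<zeta> < 1 \<and>
     (\<forall>i. finite (H i) \<and>
          (\<forall>(j, g)\<in>H i. isometry g) \<and>
          inj_on (tile_of (scaled_tiles \<zeta> T)) (H i) \<and>
          tiling (tile_of (scaled_tiles \<zeta> T) ` H i) (T i))"

definition extend_subst ::
  "('n \<Rightarrow> ('n, 'a) copy set) \<Rightarrow> ('n, 'a) copy set \<Rightarrow> ('n, 'a) copy set" where
  "extend_subst H Q = (\<Union>(i, g)\<in>Q. (\<lambda>(j, f). (j, g \<circ> f)) ` H i)"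

text \<open>Rescaling by \<open>1/\<zeta>\<close> turns the copy \<open>g ` (\<zeta> T j)\<close> into \<open>(\<lambda>x. (1/\<zeta>) g (\<zeta> x)) ` T j\<close>.\<close>

definition rescale ::
  "real \<Rightarrow> ('n, 'a::euclidean_space) copy set \<Rightarrow> ('n, 'a) copy set" where
  "rescale \<zeta> Q = (\<lambda>(j, g). (j, \<lambda>x. (1 / \<zeta>) *\<^sub>R g (\<zeta> *\<^sub>R x))) ` Q"

definition inflate ::
  "real \<Rightarrow> ('n \<Rightarrow> ('n, 'a::euclidean_space) copy set) \<Rightarrow> ('n, 'a) copy set \<Rightarrow> ('n, 'a) copy set" where
  "inflate \<zeta> H Q = rescale \<zeta> (extend_subst H Q)"

definition supertile_patches ::
  "('n \<Rightarrow> 'a::euclidean_space set) \<Rightarrow> real \<Rightarrow> ('n \<Rightarrow> ('n, 'a) copy set) \<Rightarrow> 'a set set set" where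
  "supertile_patches T \<zeta> H = {tile_of T ` ((inflate \<zeta> H ^^ m) {(i, id)}) | m i. True}"

definition tiling_space ::
  "('n \<Rightarrow> 'a::euclidean_space set) \<Rightarrow> real \<Rightarrow> ('n \<Rightarrow> ('n, 'a) copy set) \<Rightarrow> 'a set set set" where
  "tiling_space T \<zeta> H =
     {\<tau>. tiling \<tau> UNIV \<and>
         (\<forall>S\<in>\<tau>. \<exists>i g. isometry g \<and> S = g ` T i) \<and>
         (\<forall>K. compact K \<longrightarrow>
            (\<exists>P\<in>supertile_patches T \<zeta> H. \<exists>\<phi>. isometry \<phi> \<and> (`) \<phi> ` {S \<in> \<tau>. S \<subseteq> K} \<subseteq> P))}"

definition subst_matrix :: "('n::finite \<Rightarrow> ('n, 'a) copy set) \<Rightarrow> nat ^ 'n ^ 'n" where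
  "subst_matrix H = (\<chi> i j. card {g. (i, g) \<in> H j})"

text \<open>The \<open>^\<close> on \<open>vec\<close> is componentwise, hence the iterated matrix product.\<close>

definition primitive_subst :: "('n::finite \<Rightarrow> ('n, 'a) copy set) \<Rightarrow> bool" where
  "primitive_subst H \<longleftrightarrow>
     (\<exists>m. \<forall>i j. (((**) (subst_matrix H)) ^^ m) (mat 1) $ i $ j > 0)"

definition choice_function :: "('n \<Rightarrow> 'a set) \<Rightarrow> ('n \<Rightarrow> 'a) \<Rightarrow> bool" where
  "choice_function T h \<longleftrightarrow> (\<forall>i. h i \<in> T i)"

text \<open>
  \<open>Y\<close> consists of one point for each tile \<open>S\<close> of \<open>\<tau>\<close>: writing \<open>S = g (T i)\<close>, the point \<open>g (h i)\<close>.
  If a tile can be written in this form in several ways, any of them may be used for it.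
\<close>

definition picked_points ::
  "('n \<Rightarrow> 'a::euclidean_space set) \<Rightarrow> ('n \<Rightarrow> 'a) \<Rightarrow> 'a set set \<Rightarrow> 'a set \<Rightarrow> bool" where
  "picked_points T h \<tau> Y \<longleftrightarrow>
     (\<exists>\<iota> g. (\<forall>S\<in>\<tau>. isometry (g S) \<and> S = g S ` T (\<iota> S)) \<and>
            Y = (\<lambda>S. g S (h (\<iota> S))) ` \<tau>)"

definition tile_vertices :: "'a::euclidean_space set set \<Rightarrow> 'a set" where
  "tile_vertices \<tau> = (\<Union>S\<in>\<tau>. {v. v extreme_point_of S})"

end

theory Submission
  imports Defs
begin

text \<open>
  Look at a supertile of level \<open>m\<close> from one of its facets \<open>F\<close>, and record the heights over \<open>F\<close>,
  up to height 1, of all marked points (prescribed points or vertices) in it. It consists of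
  supertiles of level \<open>m - 1\<close>. Those having a facet on \<open>F\<close> contribute heights that already occur
  at level \<open>m - 1\<close>. The others meet \<open>F\<close> in dimension at most \<open>d - 2\<close>, and up to scaling they sit
  in finitely many positions relative to \<open>F\<close>, so a packing bound shows that they contribute only
  \<open>O(\<xi>^(m (d - 2)))\<close> heights. Hence \<open>N = O(m \<xi>^(m (d - 2)))\<close> heights occur in all, and one of
  \<open>N + 1\<close> parallel slices of a slab of height 1 over \<open>F\<close> contains no marked point. Its volume is
  of order \<open>\<xi>^(m (d - 1)) / N\<close>, which is unbounded in \<open>m\<close>. Finally, every tiling in the tiling
  space contains supertiles of every level.
\<close>

subsection \<open>Isometries\<close>

text \<open>Along a facet a level \<open>m\<close> supertile has of the order of \<xi>^(m (d - 1))
  tiles, as much as the slab has volume, so one slice for each marked point would only give slices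
  of bounded volume. The gain comes from counting heights instead of points: an isometry preserves
  heights, so all pieces that lie on \<open>F\<close> with the same facet of the same type share
  their heights. For the recursion to close, the heights over all facets of all basic tiles are
  collected in one set; a piece on \<open>F\<close> then contributes to the same set one level
  lower. The resulting lower bound for the volume is of order \<xi>^m / m. Both claims are treated
  together by marking finitely many points in each basic tile. For prescribed points finiteness
  needs an argument, since a tile may be written as g (T i) in many ways: the candidates are the
  images of \<open>h i\<close> under all isometries of one basic tile onto another, and these are
  controlled by the vertices.\<close>

lemma isometry_comp: "isometry f \<Longrightarrow> isometry g \<Longrightarrow> isometry (f \<circ> g)"
  by (simp add: isometry_def)

lemma isometry_affine:
  assumes "isometry g"
  obtains A t where "orthogonal_transformation A" "g = (\<lambda>x. t + A x)"
proof
  show "orthogonal_transformation (\<lambda>x. g x - g 0)"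
    using assms by (simp add: orthogonal_transformation_isometry isometry_def dist_norm)
  show "g = (\<lambda>x. g 0 + (g x - g 0))"
    by simp
qed

lemma isometry_bij:
  assumes "isometry g"
  shows "bij g"
proof -
  obtain A t where A: "orthogonal_transformation A" "g = (\<lambda>x. t + A x)"
    by (rule isometry_affine[OF assms])
  have "g = (+) t \<circ> A"
    using A(2) by auto
  then show ?thesis
    using bij_comp[OF orthogonal_transformation_bij[OF A(1)] bij_plus] by simp
qed

lemma isometry_inv:
  assumes "isometry g"
  shows "isometry (inv g)"
proof -
  have "dist (g (inv g x)) (g (inv g y)) = dist (inv g x) (inv g y)" for x y
    using assms by (simp add: isometry_def)
  then show ?thesis
    using bij_is_surj[OF isometry_bij[OF assms]] by (simp add: isometry_def surj_f_inv_f)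
qed

lemma isometry_inv_cancel:
  assumes "isometry g"
  shows "inv g (g x) = x" "g (inv g x) = x"
  using isometry_bij[OF assms] by (simp_all add: bij_is_inj bij_is_surj surj_f_inv_f)

lemma isometry_image_ball:
  assumes "isometry g"
  shows "g ` ball c r = ball (g c) r"
proof
  show "g ` ball c r \<subseteq> ball (g c) r"
    using assms by (auto simp: isometry_def)
  show "ball (g c) r \<subseteq> g ` ball c r"
  proof
    fix y assume "y \<in> ball (g c) r"
    then have "dist (g c) (g (inv g y)) < r"
      by (simp add: isometry_inv_cancel[OF assms])
    then have "inv g y \<in> ball c r"
      using assms by (simp add: isometry_def)
    then show "y \<in> g ` ball c r"
      using isometry_inv_cancel(2)[OF assms, of y] by (metis image_eqI)
  qed
qed

lemma isometry_interior_image: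
  assumes "isometry g"
  shows "interior (g ` S) = g ` interior S"
proof -
  obtain A t where A: "orthogonal_transformation A" "g = (\<lambda>x. t + A x)"
    by (rule isometry_affine[OF assms])
  have *: "g ` X = (+) t ` A ` X" for X
    by (simp add: A(2) image_image)
  show ?thesis
    unfolding *
    by (simp add: interior_translation interior_injective_linear_image
        orthogonal_transformation_linear[OF A(1)] orthogonal_transformation_inj[OF A(1)])
qed

lemma isometry_convex_image:
  assumes "isometry g" "convex C"
  shows "convex (g ` C)"
proof -
  obtain A t where A: "orthogonal_transformation A" "g = (\<lambda>x. t + A x)"
    by (rule isometry_affine[OF assms(1)])
  have *: "g ` X = (+) t ` A ` X" for X
    by (simp add: A(2) image_image)
  show ?thesis
    unfolding *
    using convex_linear_image convex_translation assms(2) orthogonal_transformation_linear[OF A(1)] by blast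
qed

lemma isometry_extreme_point:
  assumes "isometry g"
  shows "g x extreme_point_of (g ` S) \<longleftrightarrow> x extreme_point_of S"
proof -
  obtain A t where A: "orthogonal_transformation A" "g = (\<lambda>x. t + A x)"
    by (rule isometry_affine[OF assms])
  have *: "g ` X = (+) t ` A ` X" for X
    by (simp add: A(2) image_image)
  have [simp]: "inj A"
    by (rule orthogonal_transformation_inj[OF A(1)])
  have "x extreme_point_of S \<longleftrightarrow> A x extreme_point_of (A ` S)"
  proof -
    have "open_segment (A a) (A b) = A ` open_segment a b" for a b
      by (rule open_segment_linear_image) (simp_all add: orthogonal_transformation_linear[OF A(1)])
    then show ?thesis
      by (simp add: extreme_point_of_def inj_image_mem_iff)
  qed
  also have "\<dots> \<longleftrightarrow> t + A x extreme_point_of ((+) t ` A ` S)"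
    by (simp add: extreme_point_of_translation_eq)
  finally show ?thesis
    unfolding * by (simp add: A(2))
qed

lemma isometry_convex_combination:
  assumes "isometry g" "finite X" "sum l X = 1"
  shows "g (\<Sum>x\<in>X. l x *\<^sub>R x) = (\<Sum>x\<in>X. l x *\<^sub>R g x)"
proof -
  obtain A t where A: "orthogonal_transformation A" "g = (\<lambda>x. t + A x)"
    by (rule isometry_affine[OF assms(1)])
  have lin: "linear A"
    by (rule orthogonal_transformation_linear[OF A(1)])
  have "(\<Sum>x\<in>X. l x *\<^sub>R g x) = (\<Sum>x\<in>X. l x) *\<^sub>R t + (\<Sum>x\<in>X. l x *\<^sub>R A x)"
    by (simp add: A(2) scaleR_add_right sum.distrib scaleR_left.sum)
  also have "\<dots> = t + A (\<Sum>x\<in>X. l x *\<^sub>R x)"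
    by (simp add: assms(3) linear_sum[OF lin] linear_cmul[OF lin])
  finally show ?thesis
    by (simp add: A(2))
qed

text \<open>An isometry carrying \<open>P\<close> onto \<open>Q\<close> is determined on \<open>P\<close> by where it sends the vertices, and
  it sends them to vertices.\<close>

lemma finite_isometric_images:
  assumes P: "polytope P" and Q: "polytope Q" and p: "p \<in> P"
  shows "finite {g p |g. isometry g \<and> g ` P = Q}"
proof -
  define X where "X = {v. v extreme_point_of P}"
  define X' where "X' = {v. v extreme_point_of Q}"
  have fin: "finite X" "finite X'"
    unfolding X_def X'_def using P Q
    by (auto intro: finite_polyhedron_extreme_points polytope_imp_polyhedron)
  have "P = convex hull X"
    unfolding X_def
    by (intro Krein_Milman_Minkowski polytope_imp_compact polytope_imp_convex P)
  then obtain l where l: "sum l X = 1" "(\<Sum>x\<in>X. l x *\<^sub>R x) = p"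
    using p by (auto simp: convex_hull_finite[OF fin(1)])
  have "{g p |g. isometry g \<and> g ` P = Q} \<subseteq> (\<lambda>f. \<Sum>x\<in>X. l x *\<^sub>R f x) ` (X \<rightarrow>\<^sub>E X')"
  proof
    fix y assume "y \<in> {g p |g. isometry g \<and> g ` P = Q}"
    then obtain g where g: "isometry g" "g ` P = Q" "y = g p"
      by blast
    have "restrict g X \<in> X \<rightarrow>\<^sub>E X'"
      using isometry_extreme_point[OF g(1), of _ P] g(2) by (auto simp: X_def X'_def)
    moreover have "y = (\<Sum>x\<in>X. l x *\<^sub>R restrict g X x)"
      using isometry_convex_combination[OF g(1) fin(1) l(1)] l(2) g(3) by simp
    ultimately show "y \<in> (\<lambda>f. \<Sum>x\<in>X. l x *\<^sub>R f x) ` (X \<rightarrow>\<^sub>E X')"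
      by blast
  qed
  then show ?thesis
    by (rule finite_subset) (intro finite_imageI finite_PiE fin)
qed

subsection \<open>Packing\<close>

text \<open>The cells of a grid of side \<open>r / DIM('a)\<close> have diameter less than \<open>r\<close>.\<close>

lemma separated_card_bound:
  fixes Q :: "'a::euclidean_space set" and L :: "'a \<Rightarrow> real"
  assumes B: "pairwise orthogonal B" "\<And>b. b \<in> B \<Longrightarrow> norm b = 1" "card B = DIM('a)" "span B = UNIV"
    and r: "r > 0" and sep: "\<And>p q. p \<in> Q \<Longrightarrow> q \<in> Q \<Longrightarrow> p \<noteq> q \<Longrightarrow> dist p q \<ge> r"
    and L: "\<And>b. b \<in> B \<Longrightarrow> L b \<ge> 0"
    and box: "\<And>q b. q \<in> Q \<Longrightarrow> b \<in> B \<Longrightarrow> \<bar>b \<bullet> q - c b\<bar> \<le> L b"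
  shows "finite Q" "real (card Q) \<le> (\<Prod>b\<in>B. 2 * real DIM('a) * L b / r + 1)"
proof -
  define s where "s = r / DIM('a)"
  have s: "s > 0"
    using r by (simp add: s_def)
  have finB: "finite B"
    using B(3) by (metis DIM_positive card.infinite less_irrefl)
  \<comment> \<open>Adding \<open>L b\<close> makes the indices start at 0, so that in direction
    \<open>b\<close> at most \<open>2 * L b / s + 1\<close> of them occur.\<close>
  define cell where "cell q = (\<lambda>b\<in>B. \<lfloor>(b \<bullet> q - c b + L b) / s\<rfloor>)" for q
  define R where "R b = {0..\<lfloor>2 * L b / s\<rfloor>}" for b
  have inj: "inj_on cell Q"
  proof (rule inj_onI, rule ccontr)
    fix p q assume pq: "p \<in> Q" "q \<in> Q" "cell p = cell q" "p \<noteq> q"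
    have coord: "\<bar>(p - q) \<bullet> b\<bar> < s" if "b \<in> B" for b
    proof -
      have "\<lfloor>(b \<bullet> p - c b + L b) / s\<rfloor> = \<lfloor>(b \<bullet> q - c b + L b) / s\<rfloor>"
        using fun_cong[OF pq(3), of b] that by (simp add: cell_def)
      then have "\<bar>(b \<bullet> p - c b + L b) / s - (b \<bullet> q - c b + L b) / s\<bar> < 1"
        by linarith
      then have "\<bar>b \<bullet> p - b \<bullet> q\<bar> < s"
        using s by (simp add: diff_divide_distrib[symmetric])
      then show ?thesis
        using s by (simp add: inner_diff_right inner_commute[of _ b])
    qed
    have orth: "b \<bullet> b' = (if b = b' then 1 else 0)" if "b \<in> B" "b' \<in> B" for b b'
      using that B(1,2) by (auto simp: pairwise_def orthogonal_def norm_eq_1)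
    have "p - q \<in> span B"
      by (simp add: B(4))
    then obtain u where u: "p - q = (\<Sum>b\<in>B. u b *\<^sub>R b)"
      by (auto simp: span_finite[OF finB])
    have "u b = (p - q) \<bullet> b" if "b \<in> B" for b
    proof -
      have "(p - q) \<bullet> b = (\<Sum>b'\<in>B. u b' * (b' \<bullet> b))"
        by (simp add: u inner_sum_left)
      also have "\<dots> = (\<Sum>b'\<in>B. if b' = b then u b' else 0)"
        by (intro sum.cong) (use that orth in auto)
      finally show ?thesis
        using that finB by simp
    qed
    then have lt: "\<bar>u b\<bar> < s" if "b \<in> B" for b
      using coord that by simp
    \<comment> \<open>The norm is bounded by the sum of the absolute coordinates, which is why
      \<open>s\<close> carries the divisor \<open>DIM('a)\<close>.\<close>
    have "norm (p - q) \<le> (\<Sum>b\<in>B. norm (u b *\<^sub>R b))"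
      unfolding u by (rule norm_sum)
    also have "\<dots> = (\<Sum>b\<in>B. \<bar>u b\<bar>)"
      by (intro sum.cong) (use B(2) in auto)
    also have "\<dots> < (\<Sum>b\<in>B. s)"
      by (rule sum_strict_mono) (use finB B(3) lt in auto)
    also have "\<dots> = r"
      by (simp add: B(3) s_def)
    finally show False
      using sep[OF pq(1,2,4)] by (simp add: dist_norm)
  qed
  have sub: "cell ` Q \<subseteq> PiE B R"
  proof -
    have "cell q b \<in> R b" if "q \<in> Q" "b \<in> B" for q b
    proof -
      have "0 \<le> b \<bullet> q - c b + L b" "b \<bullet> q - c b + L b \<le> 2 * L b"
        using box[OF that] by linarith+
      then have "0 \<le> (b \<bullet> q - c b + L b) / s" "(b \<bullet> q - c b + L b) / s \<le> 2 * L b / s"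
        using s by (simp_all add: divide_right_mono)
      then show ?thesis
        using that(2) by (auto simp: cell_def R_def intro: floor_mono)
    qed
    then show ?thesis
      by (auto simp: cell_def)
  qed
  have finP: "finite (PiE B R)"
    by (intro finite_PiE finB) (simp add: R_def)
  show fQ: "finite Q"
    using inj sub finP finite_image_iff finite_subset by metis
  show "real (card Q) \<le> (\<Prod>b\<in>B. 2 * real DIM('a) * L b / r + 1)"
  proof -
    have "card Q \<le> card (PiE B R)"
      using inj sub finP by (metis card_image card_mono)
    also have "\<dots> = (\<Prod>b\<in>B. card (R b))"
      by (rule card_PiE[OF finB])
    finally have "real (card Q) \<le> (\<Prod>b\<in>B. real (card (R b)))"
      by (metis of_nat_le_iff of_nat_prod)
    also have "\<dots> \<le> (\<Prod>b\<in>B. 2 * real DIM('a) * L b / r + 1)"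
    proof (rule prod_mono, intro conjI)
      fix b assume "b \<in> B"
      have "real (card (R b)) \<le> 2 * L b / s + 1"
        using L[OF \<open>b \<in> B\<close>] s by (simp add: R_def) 
      also have "2 * L b / s = 2 * real DIM('a) * L b / r"
        by (simp add: s_def)
      finally show "real (card (R b)) \<le> 2 * real DIM('a) * L b / r + 1" .
    qed simp
    finally show ?thesis .
  qed
qed

text \<open>The box of the packing bound has to be thin in two given orthogonal directions at once,
  so the grid is aligned with a basis that contains both.\<close>

lemma orthonormal_basis_pair:
  fixes u w :: "'a::euclidean_space"
  assumes "norm u = 1" "norm w = 1" "u \<bullet> w = 0"
  obtains B where "u \<in> B" "w \<in> B" "pairwise orthogonal B" "\<And>b. b \<in> B \<Longrightarrow> norm b = 1"
    "card B = DIM('a)" "span B = UNIV"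
proof -
  have "pairwise orthogonal {u, w}"
    using assms(3) by (auto simp: pairwise_def orthogonal_def inner_commute)
  then obtain U where U: "U \<inter> insert 0 {u, w} = {}" "pairwise orthogonal ({u, w} \<union> U)"
      "span ({u, w} \<union> U) = span ({u, w} \<union> UNIV)"
    using orthogonal_extension_strong by blast
  define B' where "B' = {u, w} \<union> U"
  have nz: "0 \<notin> B'"
    using U(1) assms(1,2) by (auto simp: B'_def)
  have orth: "pairwise orthogonal B'" and sp: "span B' = UNIV"
    using U(2,3) by (simp_all add: B'_def)
  define n where "n x = x /\<^sub>R norm x" for x :: 'a
  define B where "B = n ` B'"
  have norm1: "norm b = 1" if b: "b \<in> B" for b
  proof -
    obtain x where "x \<in> B'" "b = n x"
      using b by (auto simp: B_def)
    then show ?thesis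
      using nz by (cases "x = 0") (auto simp: n_def)
  qed
  have orthB: "pairwise orthogonal B"
    unfolding B_def pairwise_image
    by (rule pairwise_mono[OF orth]) (auto simp: n_def orthogonal_def pairwise_def intro: pairwiseD[OF orth])
  have "0 \<notin> B"
    using norm1 by force
  then have ind: "independent B"
    using orthB by (intro pairwise_orthogonal_independent)
  have "B' \<subseteq> span B"
  proof
    fix x assume "x \<in> B'"
    then have "x \<noteq> 0"
      using nz by blast
    have "norm x *\<^sub>R n x \<in> span B"
      by (intro span_mul span_base) (simp add: B_def \<open>x \<in> B'\<close>)
    then show "x \<in> span B"
      using \<open>x \<noteq> 0\<close> by (simp add: n_def)
  qed
  then have spB: "span B = UNIV"
    using sp span_mono span_span by (metis top.extremum_unique)
  have "card B = DIM('a)"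
    using basis_card_eq_dim[OF _ _ ind, of UNIV] spB by simp
  moreover have "u \<in> B" "w \<in> B"
    using assms(1,2) by (force simp: B_def B'_def n_def)+
  ultimately show ?thesis
    using that orthB norm1 spB by blast
qed

subsection \<open>Facets of polytopes\<close>

text \<open>A facet is encoded by its inner unit normal and the offset of its hyperplane:
  \<open>u \<bullet> x - b\<close> is then the height of \<open>x\<close> over the facet, and
  scaling \<open>S\<close> by \<open>r\<close> only turns \<open>b\<close> into
  \<open>r * b\<close>. The condition on the affine hull separates facets from smaller
  contacts.\<close>

definition facet_data :: "'a::euclidean_space set \<Rightarrow> 'a \<Rightarrow> real \<Rightarrow> bool" where
  "facet_data S u b \<longleftrightarrow> norm u = 1 \<and> (\<forall>x\<in>S. b \<le> u \<bullet> x) \<and>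
     affine hull (S \<inter> {x. u \<bullet> x = b}) = {x. u \<bullet> x = b}"

lemma unit_hyperplane_eq:
  fixes u u' :: "'a::euclidean_space"
  assumes u: "norm u = 1" "norm u' = 1" and eq: "{x. u \<bullet> x = b} = {x. u' \<bullet> x = b'}"
  shows "u' = u \<and> b' = b \<or> u' = - u \<and> b' = - b"
proof -
  have uu: "u \<bullet> u = 1" "u' \<bullet> u' = 1"
    using u by (simp_all add: norm_eq_1)
  \<comment> \<open>\<open>w\<close> is the component of \<open>u'\<close> orthogonal to
    \<open>u\<close>. The points \<open>b *\<^sub>R u\<close> and \<open>b *\<^sub>R u + w\<close>
    of the first hyperplane must lie in the second one, which forces \<open>w = 0\<close>.\<close>
  define w where "w = u' - (u \<bullet> u') *\<^sub>R u"
  have "u \<bullet> (b *\<^sub>R u) = b" "u \<bullet> (b *\<^sub>R u + w) = b"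
    by (simp_all add: w_def uu inner_diff_right inner_add_right)
  then have *: "u' \<bullet> (b *\<^sub>R u) = b'" "u' \<bullet> (b *\<^sub>R u + w) = b'"
    using eq by blast+
  then have "u' \<bullet> w = 0"
    by (simp add: inner_add_right)
  then have sq: "(u \<bullet> u')\<^sup>2 = 1"
    by (simp add: w_def inner_diff_right uu inner_commute power2_eq_square)
  then have "w \<bullet> w = 0"
    using \<open>u' \<bullet> w = 0\<close> by (simp add: w_def inner_diff_left uu inner_diff_right inner_commute[of u' u] power2_eq_square)
  then have "u' = (u \<bullet> u') *\<^sub>R u"
    by (simp add: w_def)
  moreover have "u \<bullet> u' = 1 \<or> u \<bullet> u' = - 1"
    using sq by (simp add: power2_eq_1_iff)
  moreover have "b' = b * (u \<bullet> u')"
    using *(1) by (simp add: inner_commute)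
  ultimately show ?thesis
    by (metis mult.commute mult_1 mult_minus1 scaleR_minus1_left scaleR_one)
qed

lemma facet_data_gt_interior:
  assumes "facet_data S u b" "z \<in> interior S"
  shows "b < u \<bullet> z"
proof -
  obtain e where e: "e > 0" "ball z e \<subseteq> S"
    using assms(2) mem_interior by blast
  have u: "norm u = 1" "\<And>x. x \<in> S \<Longrightarrow> b \<le> u \<bullet> x"
    using assms(1) by (auto simp: facet_data_def)
  have "z - (e / 2) *\<^sub>R u \<in> ball z e"
    using e(1) u(1) by (simp add: dist_norm)
  then have "b \<le> u \<bullet> (z - (e / 2) *\<^sub>R u)"
    using e(2) u(2) by blast
  also have "\<dots> = u \<bullet> z - e / 2"
    using u(1) by (simp add: inner_diff_right norm_eq_1)
  finally show ?thesis
    using e(1) by linarith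
qed

text \<open>A polytope has finitely many faces, and the face determines the pair: its affine hull is
  the hyperplane, and an interior point decides the sign of the normal.\<close>

lemma finite_facet_data:
  fixes S :: "'a::euclidean_space set"
  assumes S: "polytope S" and int: "interior S \<noteq> {}"
  shows "finite {(u, b). facet_data S u b}"
proof -
  define F where "F = (\<lambda>(u, b). S \<inter> {x. u \<bullet> x = b})"
  have "inj_on F {(u, b). facet_data S u b}"
  proof (rule inj_onI, clarify)
    fix u b u' b'
    assume fd: "facet_data S u b" "facet_data S u' b'" and eq: "F (u, b) = F (u', b')"
    obtain z where z: "z \<in> interior S"
      using int by blast
    have "b < u \<bullet> z" "b' < u' \<bullet> z"
      using facet_data_gt_interior fd z by blast+
    moreover have "{x. u \<bullet> x = b} = {x. u' \<bullet> x = b'}"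
      using fd eq unfolding facet_data_def F_def prod.case by metis
    moreover have "norm u = 1" "norm u' = 1"
      using fd by (simp_all add: facet_data_def)
    ultimately have "u' = u \<and> b' = b \<or> u' = - u \<and> b' = - b" "b < u \<bullet> z" "b' < u' \<bullet> z"
      using unit_hyperplane_eq[of u u' b b'] by simp_all
    then show "u = u' \<and> b = b'"
      by auto
  qed
  moreover have "F ` {(u, b). facet_data S u b} \<subseteq> {G. G face_of S}"
    using face_of_Int_supporting_hyperplane_ge[OF polytope_imp_convex[OF S]]
    by (auto simp: F_def facet_data_def)
  ultimately show ?thesis
    using finite_polytope_faces[OF S] by (meson finite_imageD finite_subset)
qed

lemma facet_data_exists:
  fixes S :: "'a::euclidean_space set"
  assumes S: "polytope S" and dim: "aff_dim S = int DIM('a)"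
  obtains u b where "facet_data S u b"
proof -
  obtain F where F: "F facet_of S"
    using polytope_facet_exists[OF S] dim by auto
  then have "F face_of S" "F \<noteq> {}" and dF: "aff_dim F = int DIM('a) - 1"
    by (auto simp: facet_of_def dim)
  moreover have "F \<noteq> S"
    using dF dim by auto
  ultimately obtain a c where a: "a \<noteq> 0" "S \<subseteq> {x. a \<bullet> x \<le> c}" "F = S \<inter> {x. a \<bullet> x = c}"
    using exposed_face_of_polyhedron[OF polytope_imp_polyhedron[OF S]] exposed_face_of by metis
  \<comment> \<open>The face is exposed by a half-space bounding \<open>S\<close> from above;
    negating and normalising \<open>a\<close> gives an inner unit normal.\<close>
  define u where "u = - (a /\<^sub>R norm a)"
  define b where "b = - (c / norm a)"
  have H: "{x. u \<bullet> x = b} = {x. a \<bullet> x = c}"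
    using a(1) by (auto simp: u_def b_def field_simps)
  have "affine hull F = affine hull {x. a \<bullet> x = c}"
    using a dF by (subst aff_dim_eq_full_gen[symmetric]) auto
  then have "affine hull (S \<inter> {x. u \<bullet> x = b}) = {x. u \<bullet> x = b}"
    unfolding H a(3)[symmetric] by (simp add: affine_hyperplane)
  moreover have "b \<le> u \<bullet> x" if "x \<in> S" for x
    using a(1,2) that by (auto simp: u_def b_def field_simps)
  moreover have "norm u = 1"
    using a(1) by (simp add: u_def)
  ultimately show ?thesis
    using that[of u b] by (simp add: facet_data_def)
qed

text \<open>If the contact of \<open>S\<close> with the hyperplane is not a facet, it lies in a second hyperplane
  orthogonal to the first. The estimate is convex in \<open>x\<close>, so it suffices to check the vertices.\<close>

lemma lower_dimensional_contact:
  fixes S :: "'a::euclidean_space set"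
  assumes S: "polytope S" and u: "norm u = 1" and supp: "\<And>x. x \<in> S \<Longrightarrow> b \<le> u \<bullet> x"
    and not_facet: "\<not> facet_data S u b" and dim: "DIM('a) \<ge> 2"
  obtains w \<beta> C where "norm w = 1" "u \<bullet> w = 0" "C \<ge> 0" "\<forall>x\<in>S. \<bar>w \<bullet> x - \<beta>\<bar> \<le> C * (u \<bullet> x - b)"
proof -
  define G where "G = S \<inter> {x. u \<bullet> x = b}"
  have u0: "u \<noteq> 0"
    using u by auto
  have "affine hull G \<noteq> {x. u \<bullet> x = b}"
    using not_facet u supp unfolding facet_data_def G_def by blast
  then have "aff_dim G \<noteq> aff_dim {x. u \<bullet> x = b}"
    using aff_dim_eq_full_gen[of G "{x. u \<bullet> x = b}"] hull_same[of affine "{x. u \<bullet> x = b}"]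
      affine_hyperplane[of u b] by (simp add: G_def)
  then have dG: "aff_dim G < int DIM('a) - 1"
    using aff_dim_subset[of G "{x. u \<bullet> x = b}"] u0 by (auto simp: G_def)
  \<comment> \<open>If the hyperplane misses \<open>S\<close>, any base point will do: the dimension
    is then 0, which is below \<open>DIM('a) - 1\<close> as \<open>DIM('a) \<ge> 2\<close>.\<close>
  obtain g0 where g0: "dim ((\<lambda>x. x - g0) ` G) < DIM('a) - 1" "G = {} \<or> g0 \<in> G"
  proof (cases "G = {}")
    case True
    then show ?thesis
      using that[of 0] dim by simp
  next
    case False
    then obtain g where "g \<in> G" by blast
    then show ?thesis
      using that[of g] dG dim aff_dim_eq_dim_subtract[of g G] by (simp add: hull_inc)
  qed
  \<comment> \<open>Adding \<open>u\<close> to the directions of the contact raises the dimension by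
    at most one, which leaves room for a vector orthogonal to all of them.\<close>
  have "dim (insert u ((\<lambda>x. x - g0) ` G)) < DIM('a)"
    using g0(1) dim_insert[of u "(\<lambda>x. x - g0) ` G"] by (auto split: if_splits)
  then obtain w0 where w0: "w0 \<noteq> 0" "\<And>y. y \<in> span (insert u ((\<lambda>x. x - g0) ` G)) \<Longrightarrow> orthogonal w0 y"
    using orthogonal_to_subspace_exists by blast
  define w where "w = w0 /\<^sub>R norm w0"
  have w: "norm w = 1"
    using w0(1) by (simp add: w_def)
  have orth: "w \<bullet> y = 0" if "y \<in> insert u ((\<lambda>x. x - g0) ` G)" for y
    using w0(2)[OF span_base[OF that]] by (simp add: w_def orthogonal_def)
  define \<beta> where "\<beta> = w \<bullet> g0"
  have \<beta>: "w \<bullet> x = \<beta>" if "x \<in> G" for x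
    using orth[of "x - g0"] that by (auto simp: \<beta>_def inner_diff_right)
  obtain X where X: "finite X" "S = convex hull X"
    using S by (auto simp: polytope_def)
  have XS: "X \<subseteq> S"
    by (simp add: X hull_subset)
  \<comment> \<open>Each vertex off the hyperplane contributes the slope it requires. A vertex on it
    contributes 0 by the convention for division by zero, and there both sides of the estimate
    vanish.\<close>
  define C where "C = (\<Sum>x\<in>X. \<bar>w \<bullet> x - \<beta>\<bar> / (u \<bullet> x - b))"
  have nonneg: "\<bar>w \<bullet> x - \<beta>\<bar> / (u \<bullet> x - b) \<ge> 0" if "x \<in> X" for x
    using supp XS that by (intro divide_nonneg_nonneg) auto
  have CX: "\<bar>w \<bullet> x - \<beta>\<bar> \<le> C * (u \<bullet> x - b)" if "x \<in> X" for x
  proof (cases "u \<bullet> x = b")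
    case True
    then have "x \<in> G"
      using that XS by (auto simp: G_def)
    then show ?thesis
      using True \<beta> by simp
  next
    case False
    then have pos: "u \<bullet> x - b > 0"
      using supp XS that by fastforce
    have "\<bar>w \<bullet> x - \<beta>\<bar> / (u \<bullet> x - b) \<le> C"
      unfolding C_def by (rule member_le_sum) (use that nonneg X in auto)
    then show ?thesis
      using pos by (simp add: pos_divide_le_eq)
  qed
  define K where "K = {x. w \<bullet> x - \<beta> \<le> C * (u \<bullet> x - b)} \<inter> {x. - (w \<bullet> x - \<beta>) \<le> C * (u \<bullet> x - b)}"
  have "K = {x. (w - C *\<^sub>R u) \<bullet> x \<le> \<beta> - C * b} \<inter> {x. (- w - C *\<^sub>R u) \<bullet> x \<le> - \<beta> - C * b}"
    by (auto simp: K_def inner_diff_left algebra_simps)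
  then have "convex K"
    by (simp add: convex_Int convex_halfspace_le)
  moreover have "X \<subseteq> K"
    using CX by (auto simp: K_def abs_le_iff)
  ultimately have "S \<subseteq> K"
    unfolding X(2) by (simp add: hull_minimal)
  then have "\<bar>w \<bullet> x - \<beta>\<bar> \<le> C * (u \<bullet> x - b)" if "x \<in> S" for x
    using that by (auto simp: K_def abs_le_iff)
  moreover have "C \<ge> 0"
    unfolding C_def by (rule sum_nonneg) (rule nonneg)
  moreover have "u \<bullet> w = 0"
    using orth[of u] by (simp add: inner_commute)
  ultimately show ?thesis
    using that w by blast
qed

subsection \<open>Slabs over a facet\<close>

text \<open>The volume of a slice is estimated by how many of its translates cover a ball. An
  isometry carries such a covering to a covering of a congruent ball, so one covering settles all
  \<open>\<Psi>\<close>.\<close>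

lemma measure_isometric_image_ge:
  fixes C :: "'a::euclidean_space set"
  assumes \<Psi>: "isometry \<Psi>" and C: "convex C" "bounded C" and \<rho>: "\<rho> \<ge> 0"
    and cover: "ball c \<rho> \<subseteq> (\<Union>l<K::nat. (+) (t l) ` C)"
  shows "\<rho> ^ DIM('a) * measure lborel (ball (0::'a) 1) \<le> K * measure lebesgue (\<Psi> ` C)"
proof -
  obtain A s where A: "orthogonal_transformation A" "\<Psi> = (\<lambda>x. s + A x)"
    by (rule isometry_affine[OF \<Psi>])
  have lin: "linear A"
    by (rule orthogonal_transformation_linear[OF A(1)])
  have bdd: "bounded (\<Psi> ` C)"
    using C(2) \<Psi> unfolding bounded_def isometry_def by (metis imageE)
  have meas: "\<Psi> ` C \<in> lmeasurable"
    by (intro measurable_convex isometry_convex_image \<Psi> C bdd)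
  have "\<Psi> ` ((+) (t l) ` C) = (+) (A (t l)) ` \<Psi> ` C" for l
    by (simp add: A(2) image_image linear_add[OF lin] algebra_simps)
  then have "\<Psi> ` ball c \<rho> \<subseteq> (\<Union>l<K. (+) (A (t l)) ` \<Psi> ` C)"
    using image_mono[OF cover, of \<Psi>] by (simp add: image_UN)
  then have sub: "ball (\<Psi> c) \<rho> \<subseteq> (\<Union>l<K. (+) (A (t l)) ` \<Psi> ` C)"
    by (simp add: isometry_image_ball[OF \<Psi>])
  have meas': "(+) (A (t l)) ` \<Psi> ` C \<in> lmeasurable" for l
    using meas by (rule measurable_translation)
  have "\<rho> ^ DIM('a) * measure lborel (ball (0::'a) 1) = measure lebesgue (ball (\<Psi> c) \<rho>)"
    using content_ball_conv_unit_ball[OF \<rho>, of "\<Psi> c"] by simp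
  also have "\<dots> \<le> measure lebesgue (\<Union>l<K. (+) (A (t l)) ` \<Psi> ` C)"
    by (rule measure_mono_fmeasurable[OF sub]) (use meas' in \<open>auto intro!: fmeasurable.finite_UN\<close>)
  also have "\<dots> \<le> (\<Sum>l<K. measure lebesgue ((+) (A (t l)) ` \<Psi> ` C))"
    by (rule measure_UNION_le) (use meas' in auto)
  also have "\<dots> = K * measure lebesgue (\<Psi> ` C)"
    by (simp add: measure_translation)
  finally show ?thesis .
qed

text \<open>The slices are cut from a skew cylinder over a ball inside the facet, with its axis
  pointing to an interior point of \<open>S\<close>. About \<open>r * h * N\<close> translates of
  one slice cover a ball of radius \<open>r * \<rho>\<close>, so its volume is at least of order
  \<open>r ^ DIM('a) / (r * N)\<close>. The strict lower bound for the height makes the slices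
  disjoint and keeps the lowest one off the facet.\<close>

lemma facet_slab:
  fixes S :: "'a::euclidean_space set"
  assumes S: "convex S" "bounded S" and int: "interior S \<noteq> {}" and fd: "facet_data S u b"
  obtains \<kappa> R where "\<kappa> > 0" "R > 0"
    "\<And>r (N::nat) (k::nat). r \<ge> R \<Longrightarrow> k < N \<Longrightarrow>
       \<exists>C. convex C \<and> C \<subseteq> interior ((*\<^sub>R) r ` S) \<and>
         (\<forall>y\<in>C. real k / real N < u \<bullet> y - r * b \<and> u \<bullet> y - r * b \<le> (real k + 1) / real N) \<and>
         (\<forall>\<Psi>. isometry \<Psi> \<longrightarrow> \<kappa> * r ^ (DIM('a) - 1) / N \<le> measure lebesgue (\<Psi> ` C))"
proof -
  obtain z where z: "z \<in> interior S"
    using int by blast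
  obtain e2 where e2: "e2 > 0" "ball z e2 \<subseteq> S"
    using z mem_interior by blast
  define h where "h = u \<bullet> z - b"
  have h: "h > 0"
    using facet_data_gt_interior[OF fd z] by (simp add: h_def)
  define G where "G = S \<inter> {x. u \<bullet> x = b}"
  have u: "norm u = 1" and affG: "affine hull G = {x. u \<bullet> x = b}"
    using fd by (auto simp: facet_data_def G_def)
  have uu: "u \<bullet> u = 1"
    using u by (simp add: norm_eq_1)
  have "u \<bullet> (b *\<^sub>R u) = b"
    by (simp add: uu)
  then have "affine hull G \<noteq> {}"
    unfolding affG by blast
  then have "G \<noteq> {}"
    by auto
  then obtain x0 where "x0 \<in> rel_interior G"
    using rel_interior_eq_empty[of G] S(1) by (auto simp: G_def convex_Int convex_hyperplane)
  then obtain e1 where x0: "x0 \<in> G" and e1: "e1 > 0" "ball x0 e1 \<inter> {x. u \<bullet> x = b} \<subseteq> G"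
    by (auto simp: mem_rel_interior_ball affG)
  define e where "e = min e1 e2"
  have e: "e > 0"
    using e1 e2 by (simp add: e_def)
  \<comment> \<open>The axis of the cylinder, scaled to gain height 1 per unit:
    \<open>x0 + h *\<^sub>R v\<close> is \<open>z\<close>.\<close>
  define v where "v = (1 / h) *\<^sub>R (z - x0)"
  have ux0: "u \<bullet> x0 = b"
    using x0 by (simp add: G_def)
  have uv: "u \<bullet> v = 1"
    using h by (simp add: v_def inner_diff_right ux0 h_def)
  \<comment> \<open>Projection along the axis; membership in a slice depends only on the height and
    on the value of \<open>L\<close>.\<close>
  define L where "L p = p - (u \<bullet> p) *\<^sub>R v" for p
  have linL: "linear L"
    by (intro linearI) (simp_all add: L_def inner_add_right algebra_simps)
  have Lv: "L (p + s *\<^sub>R v) = L p" for p s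
    by (simp add: L_def inner_add_right uv algebra_simps)
  have contL: "continuous_on UNIV L"
    using linL by (simp add: linear_continuous_on linear_conv_bounded_linear)
  \<comment> \<open>The midpoint of the axis of the open cylinder \<open>P\<close> of height
    \<open>h\<close>. A small ball around it, scaled by \<open>r\<close>, is the one to be covered
    by slices.\<close>
  define q where "q = x0 + (h / 2) *\<^sub>R v"
  define P where "P = {p. b < u \<bullet> p} \<inter> {p. u \<bullet> p < b + h} \<inter> L -` ball (L x0) e"
  have "open P"
    unfolding P_def by (intro open_Int open_halfspace_gt open_halfspace_lt continuous_open_vimage)
      (use contL continuous_on_eq_continuous_at in auto)
  moreover have "q \<in> P"
    using h e by (auto simp: P_def q_def inner_add_right ux0 uv Lv)
  ultimately obtain \<rho> where \<rho>: "\<rho> > 0" "ball q \<rho> \<subseteq> P"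
    by (meson openE)
  define \<omega> where "\<omega> = measure lborel (ball (0::'a) 1)"
  define \<kappa> where "\<kappa> = \<rho> ^ DIM('a) * \<omega> / (2 * h)"
  have \<omega>: "\<omega> > 0"
    unfolding \<omega>_def by (rule content_ball_pos) simp
  have \<kappa>: "\<kappa> > 0"
    using \<rho> \<omega> h by (simp add: \<kappa>_def)
  \<comment> \<open>Then \<open>r * h \<ge> 2\<close>: heights up to 1 stay within the scaled
    cylinder, and rounding up \<open>r * h * N\<close> at most doubles it.\<close>
  define R where "R = 2 / h"
  have R: "R > 0"
    using h by (simp add: R_def)
  have main: "\<exists>C. convex C \<and> C \<subseteq> interior ((*\<^sub>R) r ` S) \<and>
         (\<forall>y\<in>C. real k / real N < u \<bullet> y - r * b \<and> u \<bullet> y - r * b \<le> (real k + 1) / real N) \<and>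
         (\<forall>\<Psi>. isometry \<Psi> \<longrightarrow> \<kappa> * r ^ (DIM('a) - 1) / N \<le> measure lebesgue (\<Psi> ` C))"
    if r: "r \<ge> R" and k: "k < N" for r :: real and N k :: nat
  proof -
    have r0: "r > 0"
      using r R by linarith
    have rh: "r * h \<ge> 2"
      using r h by (simp add: R_def pos_divide_le_eq)
    have N: "N > 0"
      using k by simp
    define C where "C = {p. r * b + real k / real N < u \<bullet> p} \<inter> {p. u \<bullet> p \<le> r * b + (real k + 1) / real N} \<inter>
      L -` ball (r *\<^sub>R L x0) (r * e)"
    have conv: "convex C"
      unfolding C_def
      by (intro convex_Int convex_halfspace_gt convex_halfspace_le convex_linear_vimage linL convex_ball)
    have heights: "\<forall>y\<in>C. real k / real N < u \<bullet> y - r * b \<and> u \<bullet> y - r * b \<le> (real k + 1) / real N"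
      by (auto simp: C_def)
    have inside: "C \<subseteq> interior ((*\<^sub>R) r ` S)"
    proof
      fix p assume p: "p \<in> C"
      define s where "s = u \<bullet> p - r * b"
      have s: "0 < s" "s \<le> 1"
      proof -
        have "real k / real N < s" "s \<le> (real k + 1) / real N"
          using heights p by (auto simp: s_def)
        moreover have "0 \<le> real k / real N" "(real k + 1) / real N \<le> (1::real)"
          using k by (auto simp: field_simps)
        ultimately show "0 < s" "s \<le> 1"
          by linarith+
      qed
      define x where "x = (1 / r) *\<^sub>R (p - s *\<^sub>R v)"
      have rx: "r *\<^sub>R x = p - s *\<^sub>R v"
        using r0 by (simp add: x_def)
      then have p_eq: "p = r *\<^sub>R (x + (s / r) *\<^sub>R v)"
        using r0 by (simp add: scaleR_add_right)
      have "r * (u \<bullet> x) = r * b"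
        using arg_cong[OF rx, of "inner u"] by (simp add: inner_diff_right uv s_def)
      then have ux: "u \<bullet> x = b"
        using r0 by simp
      have "L p - r *\<^sub>R L x0 = p - s *\<^sub>R v - r *\<^sub>R x0"
        by (simp add: L_def ux0 s_def scaleR_diff_left scaleR_diff_right)
      then have "L p - r *\<^sub>R L x0 = r *\<^sub>R (x - x0)"
        by (simp add: rx scaleR_diff_right)
      moreover have "norm (L p - r *\<^sub>R L x0) < r * e"
        using p by (auto simp: C_def dist_norm norm_minus_commute)
      ultimately have xe: "norm (x - x0) < e"
        using r0 by simp
      have "x \<in> G"
        using e1(2) xe ux by (auto simp: e_def dist_norm norm_minus_commute)
      then have xS: "x \<in> S"
        by (simp add: G_def)
      have "x + h *\<^sub>R v \<in> ball z e2"
        using xe h by (simp add: v_def dist_norm e_def algebra_simps norm_minus_commute)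
      then have c: "x + h *\<^sub>R v \<in> interior S"
        using e2(2) by (meson interior_maximal open_ball subsetD)
      \<comment> \<open>On the segment from the facet point \<open>x\<close> to the interior point
        \<open>x + h *\<^sub>R v\<close> only \<open>x\<close> itself may fail to be interior. The
        fraction \<open>s / (r * h)\<close> reaches height \<open>s\<close> after scaling by
        \<open>r\<close>.\<close>
      have "0 < s / (r * h)" "s / (r * h) \<le> 1"
        using s rh r0 h by (auto simp: field_simps)
      then have "x - (s / (r * h)) *\<^sub>R (x - (x + h *\<^sub>R v)) \<in> interior S"
        by (rule mem_interior_convex_shrink[OF S(1) c xS])
      also have "x - (s / (r * h)) *\<^sub>R (x - (x + h *\<^sub>R v)) = x + (s / r) *\<^sub>R v"
        using h by simp
      finally have "p \<in> (*\<^sub>R) r ` interior S"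
        unfolding p_eq by (rule imageI)
      also have "\<dots> = interior ((*\<^sub>R) r ` S)"
        using r0 by (intro interior_injective_linear_image[symmetric]) (auto intro: injI)
      finally show "p \<in> interior ((*\<^sub>R) r ` S)" .
    qed
    have bdd: "bounded C"
      using inside S(2) interior_subset by (meson bounded_scaling bounded_subset)
    have vol: "\<kappa> * r ^ (DIM('a) - 1) / N \<le> measure lebesgue (\<Psi> ` C)" if \<Psi>: "isometry \<Psi>" for \<Psi>
    proof -
      define K where "K = nat \<lceil>r * h * N\<rceil>"
      have rhN: "r * h * N \<ge> 1"
        using rh N mult_mono[of 1 "r * h" 1 "real N"] by simp
      have K: "real K \<le> 2 * (r * h * N)"
        using rhN by (simp add: K_def) linarith
      \<comment> \<open>The translation by \<open>(l - k) / N\<close> along the axis takes slice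
        \<open>k\<close> to slice \<open>l\<close>; \<open>K\<close> slices reach the height
        \<open>r * h\<close> of the scaled cylinder.\<close>
      have "ball (r *\<^sub>R q) (r * \<rho>) \<subseteq> (\<Union>l<K. (+) (((real l - real k) / N) *\<^sub>R v) ` C)"
      proof
        fix p assume p: "p \<in> ball (r *\<^sub>R q) (r * \<rho>)"
        define p1 where "p1 = (1 / r) *\<^sub>R p"
        have p1: "p = r *\<^sub>R p1"
          using r0 by (simp add: p1_def)
        have scaled: "norm (r *\<^sub>R x - r *\<^sub>R y) = r * norm (x - y)" for x y :: 'a
          using r0 norm_scaleR[of r "x - y"] by (simp add: scaleR_diff_right)
        have "p1 \<in> ball q \<rho>"
          using p r0 by (simp add: p1 dist_norm scaled)
        then have "p1 \<in> P"
          using \<rho> by blast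
        then have 1: "b < u \<bullet> p1" "u \<bullet> p1 < b + h" and 2: "norm (L x0 - L p1) < e"
          by (auto simp: P_def dist_norm)
        have "L p = r *\<^sub>R L p1"
          unfolding p1 by (rule linear_cmul[OF linL])
        then have "norm (r *\<^sub>R L x0 - L p) = r * norm (L x0 - L p1)"
          by (simp add: scaled)
        then have Lp: "L p \<in> ball (r *\<^sub>R L x0) (r * e)"
          using 2 r0 by (simp add: dist_norm)
        define s where "s = u \<bullet> p - r * b"
        have "s = r * (u \<bullet> p1 - b)"
          by (simp add: s_def p1 right_diff_distrib)
        then have s: "0 < s" "s < r * h"
          using 1 r0 by simp_all
        \<comment> \<open>The slice of height \<open>s\<close>; the ceiling minus one is right
          because slices are open below and closed above.\<close>
        define l where "l = nat (\<lceil>s * N\<rceil> - 1)"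
        have "s * N > 0" "s * N < r * h * N"
          using s N by auto
        then have l: "real l < s * N" "s * N \<le> real l + 1" "l < K"
          unfolding l_def K_def by linarith+
        define t where "t = (real l - real k) / N"
        define p' where "p' = p + (- t) *\<^sub>R v"
        have "u \<bullet> p' = r * b + s - t"
          by (simp add: p'_def inner_diff_right uv s_def)
        moreover have "real k / real N < s - t" "s - t \<le> (real k + 1) / real N"
        proof -
          have "(real l) / real N < s" "s \<le> (real l + 1) / real N"
            using l N by (simp_all add: pos_divide_less_eq pos_le_divide_eq)
          then show "real k / real N < s - t" "s - t \<le> (real k + 1) / real N"
            by (simp_all add: t_def diff_divide_distrib add_divide_distrib)
        qed
        moreover have "L p' \<in> ball (r *\<^sub>R L x0) (r * e)"
          unfolding p'_def Lv by (rule Lp)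
        ultimately have "p' \<in> C"
          by (auto simp: C_def)
        moreover have "p = t *\<^sub>R v + p'"
          by (simp add: p'_def)
        ultimately show "p \<in> (\<Union>l<K. (+) (((real l - real k) / N) *\<^sub>R v) ` C)"
          using l(3) by (auto simp: t_def)
      qed
      from measure_isometric_image_ge[OF \<Psi> conv bdd _ this]
      have "(r * \<rho>) ^ DIM('a) * \<omega> \<le> K * measure lebesgue (\<Psi> ` C)"
        using r0 \<rho> by (simp add: \<omega>_def)
      also have "\<dots> \<le> 2 * (r * h * N) * measure lebesgue (\<Psi> ` C)"
        by (intro mult_right_mono K) simp
      finally have "(r * \<rho>) ^ DIM('a) * \<omega> / (2 * (r * h * N)) \<le> measure lebesgue (\<Psi> ` C)"
        using r0 h N by (simp add: field_simps)
      moreover have "(r * \<rho>) ^ DIM('a) * \<omega> / (2 * (r * h * N)) = \<kappa> * r ^ (DIM('a) - 1) / N"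
        using r0 h N power_Suc[of r "DIM('a) - 1"] by (simp add: \<kappa>_def power_mult_distrib field_simps)
      ultimately show ?thesis
        by simp
    qed
    show ?thesis
      using conv inside heights vol by blast
  qed
  show ?thesis
    by (rule that[OF \<kappa> R main])
qed

section \<open>Pigeonhole for heights, and convex sets of volume at least one\<close>

text \<open>The map \<open>f\<close> sends a number to the index of its interval and has fewer than
  \<open>N\<close> values. Numbers outside all the intervals also mark an index (those \<le> 0 mark
  index 0), which only wastes it.\<close>

lemma ex_interval_avoiding:
  fixes V :: "real set"
  assumes "finite V" "card V < N"
  obtains k where "k < N" "\<And>x. x \<in> V \<Longrightarrow> \<not> (real k / real N < x \<and> x \<le> (real k + 1) / real N)"
proof -
  define f where "f x = nat (\<lceil>x * real N\<rceil> - 1)" for x :: real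
  have "card (f ` V) < card {..<N}"
    using assms card_image_le[of V f] by simp
  then have "\<not> {..<N} \<subseteq> f ` V"
    using assms(1) by (metis card_mono finite_imageI not_le)
  then obtain k where k: "k < N" "k \<notin> f ` V"
    by blast
  have "\<not> (real k / real N < x \<and> x \<le> (real k + 1) / real N)" if "x \<in> V" for x
  proof
    assume "real k / real N < x \<and> x \<le> (real k + 1) / real N"
    then have "real k < x * real N" "x * real N \<le> real k + 1"
      using k(1) by (auto simp: field_simps)
    then have "f x = k"
      unfolding f_def by linarith
    then show False
      using k(2) that by blast
  qed
  then show ?thesis
    by (rule that[OF k(1)])
qed

text \<open>A homothety centred at a point of \<open>C\<close> shrinks it to volume exactly 1, and
  by convexity the shrunken set stays inside \<open>C\<close>.\<close>

lemma danzer_set_meets: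
  fixes Y :: "'a::euclidean_space set"
  assumes Y: "danzer_set Y" and C: "convex C" "bounded C" "measure lebesgue C \<ge> 1"
  shows "Y \<inter> C \<noteq> {}"
proof -
  have meas: "C \<in> lmeasurable"
    by (rule measurable_convex[OF C(1,2)])
  define V where "V = measure lebesgue C"
  have V: "V \<ge> 1" "emeasure lebesgue C = ennreal V"
    using C(3) meas by (simp_all add: V_def emeasure_eq_measure2)
  have "C \<noteq> {}"
    using C(3) by auto
  then obtain x0 where x0: "x0 \<in> C"
    by blast
  define t where "t = root DIM('a) (1 / V)"
  have t: "0 < t" "t \<le> 1" "t ^ DIM('a) = 1 / V"
    using V(1) by (auto simp: t_def)
  define C' where "C' = (\<lambda>x. t *\<^sub>R x + (1 - t) *\<^sub>R x0) ` C"
  have "emeasure lebesgue C' = \<bar>t\<bar> ^ DIM('a) * emeasure lebesgue C"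
    unfolding C'_def by (rule emeasure_lebesgue_affine)
  also have "\<dots> = ennreal (1 / V) * ennreal V"
    using t by (simp add: V(2))
  also have "\<dots> = 1"
    using V(1) by (simp flip: ennreal_mult)
  finally have "emeasure lebesgue C' = 1" .
  moreover have "convex C'"
    unfolding C'_def using convex_affinity[OF C(1), of "(1 - t) *\<^sub>R x0" t] by (simp add: add.commute)
  moreover have "C' \<subseteq> C"
    unfolding C'_def using convexD[OF C(1) _ x0, of _ t "1 - t"] t by auto
  ultimately show ?thesis
    using Y by (auto simp: danzer_set_def)
qed

subsection \<open>Supertiles\<close>

text \<open>Conjugation by a homothety. For an isometry it keeps the linear part and multiplies the
  translation by \<open>c\<close>; inflation acts in this way on the positions of tiles, whose size
  it restores.\<close>

definition dilate :: "real \<Rightarrow> ('a::real_vector \<Rightarrow> 'a) \<Rightarrow> 'a \<Rightarrow> 'a" where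
  "dilate c g = (\<lambda>x. c *\<^sub>R g ((1 / c) *\<^sub>R x))"

lemma dilate_comp: "c \<noteq> 0 \<Longrightarrow> dilate c (f \<circ> g) = dilate c f \<circ> dilate c g"
  by (auto simp: dilate_def)

lemma dilate_dilate: "dilate c (dilate c' g) = dilate (c * c') g"
  by (auto simp: dilate_def mult.commute)

lemma dilate_1 [simp]: "dilate 1 g = g"
  by (simp add: dilate_def)

lemma isometry_dilate:
  assumes "c > 0" "isometry g"
  shows "isometry (dilate c g)"
proof -
  have "dist (c *\<^sub>R x) (c *\<^sub>R y) = c * dist x y" for x y :: 'a
    using assms(1) norm_scaleR[of c "x - y"] by (simp add: dist_norm scaleR_diff_right)
  moreover have "dist ((1 / c) *\<^sub>R x) ((1 / c) *\<^sub>R y) = dist x y / c" for x y :: 'a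
    using assms(1) norm_scaleR[of "1 / c" "x - y"] by (simp add: dist_norm scaleR_diff_right)
  ultimately show ?thesis
    using assms by (simp add: isometry_def dilate_def)
qed

lemma dilate_image: "dilate c f ` ((*\<^sub>R) a ` S) = (*\<^sub>R) c ` f ` ((*\<^sub>R) (a / c) ` S)"
  by (simp add: dilate_def image_image)

definition move :: "('a \<Rightarrow> 'a) \<Rightarrow> ('n, 'a) copy set \<Rightarrow> ('n, 'a) copy set" where
  "move g Q = (\<lambda>(j, f). (j, g \<circ> f)) ` Q"

lemma mem_move_iff: "(l, h) \<in> move g Q \<longleftrightarrow> (\<exists>f. (l, f) \<in> Q \<and> h = g \<circ> f)"
  by (auto simp: move_def)

lemma interior_scaled:
  fixes S :: "'b::euclidean_space set"
  shows "c \<noteq> 0 \<Longrightarrow> interior ((*\<^sub>R) c ` S) = (*\<^sub>R) c ` interior S"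
  by (intro interior_injective_linear_image) (auto intro: injI)

lemma scaled_disjoint:
  fixes A :: "'b::euclidean_space set"
  assumes "interior A \<inter> B = {}" "c \<noteq> 0"
  shows "interior ((*\<^sub>R) c ` A) \<inter> (*\<^sub>R) c ` B = {}"
  using assms by (auto simp: interior_scaled)

lemma disjoint_mono: "interior A \<inter> B = {} \<Longrightarrow> A' \<subseteq> A \<Longrightarrow> B' \<subseteq> B \<Longrightarrow> interior A' \<inter> B' = {}"
  using interior_mono by blast

section \<open>The tiles of a supertile and its decomposition into smaller supertiles\<close>

locale polygonal_substitution =
  fixes T :: "'n::finite \<Rightarrow> 'a::euclidean_space set"
    and \<zeta> :: real
    and H :: "'n \<Rightarrow> ('n, 'a) copy set"
  assumes dim: "DIM('a) \<ge> 2"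
    and poly: "polygonal_tile (T i)"
    and subst: "substitution T \<zeta> H"
begin

definition \<xi> :: real where "\<xi> = 1 / \<zeta>"

lemma zeta: "0 < \<zeta>" "\<zeta> < 1"
  using subst by (auto simp: substitution_def)

lemma xi: "\<xi> > 1"
  using zeta by (simp add: \<xi>_def)

lemma xi_pow_pos [simp]: "\<xi> ^ m > 0"
  using xi by simp

lemma finite_H: "finite (H i)"
  using subst by (auto simp: substitution_def)

lemma isometry_H: "(j, f) \<in> H i \<Longrightarrow> isometry f"
  using subst by (auto simp: substitution_def)

lemma H_subset: "(j, f) \<in> H i \<Longrightarrow> f ` ((*\<^sub>R) \<zeta> ` T j) \<subseteq> T i"
proof -
  assume "(j, f) \<in> H i"
  then have "f ` ((*\<^sub>R) \<zeta> ` T j) \<subseteq> \<Union> (tile_of (scaled_tiles \<zeta> T) ` H i)"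
    by (force simp: tile_of_def scaled_tiles_def)
  then show ?thesis
    using subst by (auto simp: substitution_def tiling_def)
qed

text \<open>The injectivity clause of \<open>substitution\<close> turns different pairs into
  different tiles; these meet only in their frontiers.\<close>

lemma H_nonoverlap:
  assumes "(j, f) \<in> H i" "(j', f') \<in> H i" "(j, f) \<noteq> (j', f')"
  shows "interior (f ` ((*\<^sub>R) \<zeta> ` T j)) \<inter> f' ` ((*\<^sub>R) \<zeta> ` T j') = {}"
proof -
  have "inj_on (tile_of (scaled_tiles \<zeta> T)) (H i)"
    and til: "tiling (tile_of (scaled_tiles \<zeta> T) ` H i) (T i)"
    using subst by (auto simp: substitution_def)
  then have "tile_of (scaled_tiles \<zeta> T) (j, f) \<noteq> tile_of (scaled_tiles \<zeta> T) (j', f')"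
    using assms by (metis inj_onD)
  then have "tile_of (scaled_tiles \<zeta> T) (j, f) \<inter> tile_of (scaled_tiles \<zeta> T) (j', f')
      \<subseteq> frontier (tile_of (scaled_tiles \<zeta> T) (j, f))"
    using til assms unfolding tiling_def by blast
  then show ?thesis
    using interior_subset by (fastforce simp: tile_of_def scaled_tiles_def frontier_def)
qed

definition patch :: "nat \<Rightarrow> 'n \<Rightarrow> ('n, 'a) copy set" where
  "patch m i = (inflate \<zeta> H ^^ m) {(i, id)}"

lemma patch_0 [simp]: "patch 0 i = {(i, id)}"
  by (simp add: patch_def)

lemma inflate_eq: "inflate \<zeta> H Q = (\<Union>(i, g)\<in>Q. (\<lambda>(j, f). (j, dilate \<xi> (g \<circ> f))) ` H i)"
  by (force simp: inflate_def rescale_def extend_subst_def dilate_def \<xi>_def image_UN image_image)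

lemma mem_inflate_iff:
  "(j, h) \<in> inflate \<zeta> H Q \<longleftrightarrow> (\<exists>i g f. (i, g) \<in> Q \<and> (j, f) \<in> H i \<and> h = dilate \<xi> (g \<circ> f))"
  unfolding inflate_eq by force

lemma inflate_move: "inflate \<zeta> H (move g Q) = move (dilate \<xi> g) (inflate \<zeta> H Q)"
proof -
  have "dilate \<xi> (g \<circ> f \<circ> f') = dilate \<xi> g \<circ> dilate \<xi> (f \<circ> f')" for f f'
    using dilate_comp[of \<xi> g "f \<circ> f'"] xi by (simp add: comp_assoc)
  then have "(j, h) \<in> inflate \<zeta> H (move g Q) \<longleftrightarrow> (j, h) \<in> move (dilate \<xi> g) (inflate \<zeta> H Q)" for j h
    unfolding mem_inflate_iff mem_move_iff by metis
  then show ?thesis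
    by auto
qed

lemma inflate_UN: "inflate \<zeta> H (\<Union>x\<in>X. F x) = (\<Union>x\<in>X. inflate \<zeta> H (F x))"
  by (force simp: inflate_eq)

text \<open>Source of both decompositions of a supertile: \<open>patch_Suc\<close> arranges level
  \<open>m\<close> supertiles like the pieces of \<open>H i\<close>, and \<open>patch_add\<close>
  arranges them like the tiles of a level \<open>k\<close> supertile.\<close>

lemma inflate_power: "(inflate \<zeta> H ^^ m) Q = (\<Union>(j, g)\<in>Q. move (dilate (\<xi> ^ m) g) (patch m j))"
proof (induction m)
  case 0
  have "(\<Union>(j, g)\<in>Q. move g {(j, id)}) = Q"
    by (force simp: move_def)
  then show ?case
    by simp
next
  case (Suc m)
  have "inflate \<zeta> H (move (dilate (\<xi> ^ m) g) (patch m j)) = move (dilate (\<xi> ^ Suc m) g) (patch (Suc m) j)" for j g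
    by (simp add: inflate_move dilate_dilate patch_def)
  then show ?case
    by (simp add: Suc.IH inflate_UN case_prod_unfold)
qed

lemma patch_add: "patch (m + k) i = (\<Union>(j, g)\<in>patch k i. move (dilate (\<xi> ^ m) g) (patch m j))"
  unfolding patch_def[of "m + k"] funpow_add comp_def patch_def[symmetric] by (rule inflate_power)

lemma patch_1: "patch (Suc 0) i = (\<lambda>(j, f). (j, dilate \<xi> f)) ` H i"
  by (simp add: patch_def inflate_eq)

lemma patch_Suc: "patch (Suc m) i = (\<Union>(j, f)\<in>H i. move (dilate (\<xi> ^ Suc m) f) (patch m j))"
  using patch_add[of m "Suc 0" i] xi
  by (simp add: patch_1 image_image case_prod_unfold dilate_dilate mult.commute)

lemma mem_patch_Suc_iff:
  "(l, h) \<in> patch (Suc m) i \<longleftrightarrow>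
     (\<exists>j f f'. (j, f) \<in> H i \<and> (l, f') \<in> patch m j \<and> h = dilate (\<xi> ^ Suc m) f \<circ> f')"
  unfolding patch_Suc by (force simp: mem_move_iff)

lemma mem_patch_add_iff:
  "(l, h) \<in> patch (m + k) i \<longleftrightarrow>
     (\<exists>j g f. (j, g) \<in> patch k i \<and> (l, f) \<in> patch m j \<and> h = dilate (\<xi> ^ m) g \<circ> f)"
  unfolding patch_add by (force simp: mem_move_iff)

lemma finite_patch: "finite (patch m i)"
  by (induction m arbitrary: i) (auto simp: patch_Suc move_def finite_H)

lemma isometry_patch: "(l, h) \<in> patch m i \<Longrightarrow> isometry h"
proof (induction m arbitrary: i l h)
  case 0
  then show ?case by (simp add: isometry_def)
next
  case (Suc m)
  then show ?case
    unfolding mem_patch_Suc_iff using isometry_comp isometry_dilate isometry_H xi_pow_pos by blast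
qed

lemma dilate_image_Suc:
  "dilate (\<xi> ^ Suc m) f ` ((*\<^sub>R) (\<xi> ^ m) ` S) = (*\<^sub>R) (\<xi> ^ Suc m) ` f ` ((*\<^sub>R) \<zeta> ` S)"
proof -
  have "\<xi> ^ m / \<xi> ^ Suc m = \<zeta>"
    using xi zeta by (simp add: \<xi>_def field_simps)
  then show ?thesis
    unfolding dilate_image by (simp only:)
qed

lemma patch_subset: "(l, h) \<in> patch m i \<Longrightarrow> h ` T l \<subseteq> (*\<^sub>R) (\<xi> ^ m) ` T i"
proof (induction m arbitrary: i l h)
  case 0
  then show ?case by simp
next
  case (Suc m)
  then obtain j f f' where jf: "(j, f) \<in> H i" "(l, f') \<in> patch m j" "h = dilate (\<xi> ^ Suc m) f \<circ> f'"
    unfolding mem_patch_Suc_iff by blast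
  have "h ` T l \<subseteq> dilate (\<xi> ^ Suc m) f ` ((*\<^sub>R) (\<xi> ^ m) ` T j)"
    using Suc.IH[OF jf(2)] unfolding jf(3) image_comp[symmetric] by (rule image_mono)
  also have "\<dots> \<subseteq> (*\<^sub>R) (\<xi> ^ Suc m) ` T i"
    unfolding dilate_image_Suc by (intro image_mono H_subset jf)
  finally show ?case .
qed

text \<open>Two tiles in the same piece are covered by induction, moved by the isometry of that
  piece; tiles in different pieces are separated because the pieces themselves are.\<close>

lemma patch_nonoverlap:
  assumes "(l, h) \<in> patch m i" "(l', h') \<in> patch m i" "(l, h) \<noteq> (l', h')"
  shows "interior (h ` T l) \<inter> h' ` T l' = {}"
  using assms
proof (induction m arbitrary: i l h l' h')
  case 0
  then show ?case by simp
next
  case (Suc m)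
  let ?d = "dilate (\<xi> ^ Suc m)"
  obtain j f g where 1: "(j, f) \<in> H i" "(l, g) \<in> patch m j" "h = ?d f \<circ> g"
    using Suc.prems(1) unfolding mem_patch_Suc_iff by blast
  obtain j' f' g' where 2: "(j', f') \<in> H i" "(l', g') \<in> patch m j'" "h' = ?d f' \<circ> g'"
    using Suc.prems(2) unfolding mem_patch_Suc_iff by blast
  have iso: "isometry (?d f)"
    by (intro isometry_dilate isometry_H[OF 1(1)]) (rule xi_pow_pos)
  show ?case
  proof (cases "(j, f) = (j', f')")
    case True
    then have "(l, g) \<noteq> (l', g')" "(l', g') \<in> patch m j"
      using 1 2 Suc.prems(3) by auto
    then have "interior (g ` T l) \<inter> g' ` T l' = {}"
      by (intro Suc.IH[OF 1(2)])
    then have "?d f ` (interior (g ` T l) \<inter> g' ` T l') = {}"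
      by simp
    then have "interior (?d f ` g ` T l) \<inter> ?d f ` g' ` T l' = {}"
      unfolding isometry_interior_image[OF iso] image_Int[OF bij_is_inj[OF isometry_bij[OF iso]]] .
    then show ?thesis
      using True unfolding 1(3) 2(3) image_comp by simp
  next
    case False
    have nz: "\<xi> ^ Suc m \<noteq> 0"
      using xi_pow_pos[of "Suc m"] by linarith
    have "interior (?d f ` ((*\<^sub>R) (\<xi> ^ m) ` T j)) \<inter> ?d f' ` ((*\<^sub>R) (\<xi> ^ m) ` T j') = {}"
      unfolding dilate_image_Suc by (intro scaled_disjoint H_nonoverlap[OF 1(1) 2(1) False] nz)
    then show ?thesis
      unfolding 1(3) 2(3) image_comp[symmetric]
      by (rule disjoint_mono) (intro image_mono patch_subset 1 2)+
  qed
qed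

text \<open>The level \<open>m\<close> supertiles inside a level \<open>m + k\<close> supertile are
  the tiles of \<open>patch k i\<close> magnified by \<open>\<xi> ^ m\<close>.\<close>

lemma supertile_nonoverlap:
  assumes "(j, g) \<in> patch k i" "(j', g') \<in> patch k i" "(j, g) \<noteq> (j', g')"
  shows "interior (dilate (\<xi> ^ m) g ` ((*\<^sub>R) (\<xi> ^ m) ` T j)) \<inter>
    dilate (\<xi> ^ m) g' ` ((*\<^sub>R) (\<xi> ^ m) ` T j') = {}"
proof -
  have "\<xi> ^ m \<noteq> 0"
    using xi_pow_pos[of m] by linarith
  then show ?thesis
    unfolding dilate_image using patch_nonoverlap[OF assms] by (intro scaled_disjoint) auto
qed

section \<open>Uniform size bounds for the basic tiles\<close>

lemma polytope_T: "polytope (T i)"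
  using poly by (simp add: polygonal_tile_def)

lemma aff_dim_T: "aff_dim (T i) = int DIM('a)"
  using poly by (simp add: polygonal_tile_def)

lemma convex_T: "convex (T i)" and bounded_T: "bounded (T i)"
  using polytope_T polytope_imp_convex polytope_imp_bounded by blast+

lemma interior_T: "interior (T i) \<noteq> {}"
proof -
  have "T i \<noteq> {}"
    using aff_dim_T[of i] by auto
  then show ?thesis
    using interior_rel_interior_gen[of "T i"] rel_interior_eq_empty[OF convex_T, of i]
    by (simp add: aff_dim_T)
qed

lemma tile_bound:
  obtains D where "D > 0" "\<And>i x. x \<in> T i \<Longrightarrow> norm x \<le> D"
proof -
  have "bounded (\<Union>i. T i)"
    by (intro bounded_UN) (simp_all add: bounded_T)
  then obtain D where "D > 0" "\<forall>x\<in>(\<Union>i. T i). norm x \<le> D"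
    using bounded_pos by blast
  then show ?thesis
    using that by blast
qed

lemma tile_inball:
  obtains z r where "r > 0" "\<forall>i. ball (z i) r \<subseteq> T i"
proof -
  have "\<exists>z r. r > 0 \<and> ball z r \<subseteq> T i" for i
    using interior_T[of i] mem_interior by blast
  then obtain z r where zr: "\<And>i. r i > 0" "\<And>i. ball (z i) (r i) \<subseteq> T i"
    by metis
  define r0 where "r0 = Min (range r)"
  have "r0 > 0"
    using zr(1) by (simp add: r0_def)
  moreover have "ball (z i) r0 \<subseteq> T i" for i
  proof -
    have "r0 \<le> r i"
      by (simp add: r0_def)
    then show ?thesis
      using zr(2)[of i] by force
  qed
  ultimately show ?thesis
    using that by blast
qed

text \<open>The ball of radius \<open>r\<close> about a centre lies in the interior of its own tile,
  where no point of another tile can be.\<close>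

lemma patch_centres_separated:
  assumes "\<And>i. ball (z i) r \<subseteq> T i" and "r > 0"
    and "(l, h) \<in> patch m i" "(l', h') \<in> patch m i" "(l, h) \<noteq> (l', h')"
  shows "dist (h (z l)) (h' (z l')) \<ge> r"
proof (rule ccontr)
  assume "\<not> ?thesis"
  then have "h' (z l') \<in> ball (h (z l)) r"
    by simp
  also have "\<dots> = h ` ball (z l) r"
    using isometry_image_ball isometry_patch assms(3) by metis
  also have "\<dots> \<subseteq> interior (h ` T l)"
    unfolding isometry_interior_image[OF isometry_patch[OF assms(3)]]
    by (intro image_mono interior_maximal assms) simp
  finally have "h' (z l') \<in> interior (h ` T l)" .
  moreover have "h' (z l') \<in> h' ` T l'"
    using assms(1)[of l'] \<open>r > 0\<close> by (meson centre_in_ball imageI subsetD)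
  ultimately show False
    using patch_nonoverlap[OF assms(3-5)] by blast
qed

end

section \<open>Supertiles of every level in a tiling\<close>

text \<open>The tiles of \<tau> in a large ball embed in some level \<open>M\<close> supertile. A
  large enough ball forces \<open>M \<ge> m\<close>, so this supertile splits into level
  \<open>m\<close> supertiles, and the one around the image of 0 is pulled back to \<tau>.\<close>

lemma (in polygonal_substitution) supertile_in_tiling:
  assumes \<tau>: "\<tau> \<in> tiling_space T \<zeta> H"
  obtains j \<Psi> where "isometry \<Psi>"
    "\<And>S. S \<in> \<tau> \<Longrightarrow> S \<inter> interior (\<Psi> ` ((*\<^sub>R) (\<xi> ^ m) ` T j)) \<noteq> {} \<Longrightarrow>
       \<exists>l h. (l, h) \<in> patch m j \<and> S = \<Psi> ` h ` T l"
proof -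
  obtain D where D: "D > 0" "\<And>i x. x \<in> T i \<Longrightarrow> norm x \<le> D"
    using tile_bound by blast
  have scaled_norm: "norm x \<le> \<xi> ^ k * D" if "x \<in> (*\<^sub>R) (\<xi> ^ k) ` T i" for x k i
    using that D(2) xi by (auto intro!: mult_left_mono)
  have dist_le: "dist x y \<le> 2 * B" if "norm x \<le> B" "norm y \<le> B" for x y :: 'a and B
    using that norm_triangle_ineq4[of x y] by (simp add: dist_norm)
  have til: "\<Union>\<tau> = UNIV" and copies: "\<And>S. S \<in> \<tau> \<Longrightarrow> \<exists>i g. isometry g \<and> S = g ` T i"
    using \<tau> by (auto simp: tiling_space_def tiling_def)
  have diam: "dist x y \<le> 2 * D" if "S \<in> \<tau>" "x \<in> S" "y \<in> S" for S x y
  proof -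
    obtain i g where "isometry g" "S = g ` T i"
      using copies \<open>S \<in> \<tau>\<close> by blast
    then show ?thesis
      using that D(2) dist_le[of _ D] by (auto simp: isometry_def)
  qed
  \<comment> \<open>Points of a level \<open>m\<close> supertile are at most
    \<open>2 * (\<xi> ^ m * D)\<close> apart and points of a tile at most \<open>2 * D\<close>; the
    1 leaves room for the antipodal points used next.\<close>
  define r where "r = 2 * (\<xi> ^ m * D) + 2 * D + 1"
  have inK: "S \<subseteq> cball 0 r" if "S \<in> \<tau>" "x \<in> S" "norm x \<le> 2 * (\<xi> ^ m * D) + 1" for S x
  proof
    fix y assume "y \<in> S"
    then have "dist x y \<le> 2 * D"
      using diam that by blast
    then show "y \<in> cball 0 r"
      using that(3) norm_triangle_ineq[of x "y - x"] by (simp add: r_def dist_norm norm_minus_commute)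
  qed
  have "\<exists>P\<in>supertile_patches T \<zeta> H. \<exists>\<phi>. isometry \<phi> \<and> (`) \<phi> ` {S \<in> \<tau>. S \<subseteq> cball 0 r} \<subseteq> P"
    using \<tau> by (simp add: tiling_space_def)
  then obtain M i0 \<phi> where \<phi>: "isometry \<phi>"
    and sub: "(`) \<phi> ` {S \<in> \<tau>. S \<subseteq> cball 0 r} \<subseteq> tile_of T ` patch M i0"
    by (auto simp: supertile_patches_def patch_def)
  have in_patch: "\<exists>l h. (l, h) \<in> patch M i0 \<and> \<phi> ` S = h ` T l" if "S \<in> \<tau>" "S \<subseteq> cball 0 r" for S
  proof -
    have "\<phi> ` S \<in> tile_of T ` patch M i0"
      using sub that by blast
    then show ?thesis
      by (auto simp: tile_of_def)
  qed
  \<comment> \<open>Otherwise the images of two antipodal points of norm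
    \<open>\<xi> ^ m * D + 1\<close> would both have norm at most \<open>\<xi> ^ m * D\<close>,
    although their distance is preserved.\<close>
  have "m \<le> M"
  proof (rule ccontr)
    assume "\<not> m \<le> M"
    then have le: "\<xi> ^ M * D \<le> \<xi> ^ m * D"
      using xi D(1) by (intro mult_right_mono power_increasing) auto
    obtain e :: 'a where e: "e \<in> Basis"
      using nonempty_Basis by blast
    define x where "x = (\<xi> ^ m * D + 1) *\<^sub>R e"
    have "\<xi> ^ m * D > 0"
      using D(1) by simp
    then have nx: "norm x = \<xi> ^ m * D + 1"
      using e by (simp add: x_def)
    have small: "norm (\<phi> y) \<le> \<xi> ^ m * D" if "norm y = \<xi> ^ m * D + 1" for y
    proof -
      obtain S where S: "S \<in> \<tau>" "y \<in> S"
        using til by blast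
      have "S \<subseteq> cball 0 r"
        using inK[OF S] that D(1) by (simp add: less_imp_le)
      then obtain l h where "(l, h) \<in> patch M i0" "\<phi> ` S = h ` T l"
        using in_patch S(1) by blast
      then have "\<phi> y \<in> (*\<^sub>R) (\<xi> ^ M) ` T i0"
        using patch_subset S(2) by blast
      then show ?thesis
        using scaled_norm le by force
    qed
    have "dist (\<phi> x) (\<phi> (- x)) \<le> 2 * (\<xi> ^ m * D)"
      by (intro dist_le small) (simp_all add: nx)
    also have "dist (\<phi> x) (\<phi> (- x)) = norm (2 *\<^sub>R x)"
      using \<phi> by (simp add: isometry_def dist_norm scaleR_2)
    finally show False
      by (simp add: nx)
  qed
  then obtain k where M: "M = m + k"
    using le_Suc_ex by blast
  obtain S0 where S0: "S0 \<in> \<tau>" "0 \<in> S0"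
    using til by blast
  have "S0 \<subseteq> cball 0 r"
    using inK[OF S0] mult_pos_pos[OF xi_pow_pos[of m] D(1)] by simp
  then obtain l0 h0 where l0: "(l0, h0) \<in> patch M i0" "\<phi> ` S0 = h0 ` T l0"
    using in_patch S0(1) by blast
  then obtain j g f0 where j: "(j, g) \<in> patch k i0" "(l0, f0) \<in> patch m j" "h0 = dilate (\<xi> ^ m) g \<circ> f0"
    unfolding M mem_patch_add_iff by blast
  define G where "G = dilate (\<xi> ^ m) g"
  define \<Sigma> where "\<Sigma> = (*\<^sub>R) (\<xi> ^ m) ` T j"
  have G: "isometry G"
    unfolding G_def by (intro isometry_dilate isometry_patch[OF j(1)]) simp
  have inv_\<phi>: "isometry (inv \<phi>)"
    by (rule isometry_inv[OF \<phi>])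
  have "\<phi> 0 \<in> \<phi> ` S0"
    using S0(2) by (rule imageI)
  also have "\<dots> = G ` f0 ` T l0"
    by (simp add: l0(2) j(3) G_def image_comp)
  also have "\<dots> \<subseteq> G ` \<Sigma>"
    unfolding \<Sigma>_def by (intro image_mono patch_subset j)
  finally have \<phi>0: "\<phi> 0 \<in> G ` \<Sigma>" .
  have "\<exists>l h. (l, h) \<in> patch m j \<and> S = (inv \<phi> \<circ> G) ` h ` T l"
    if S: "S \<in> \<tau>" "S \<inter> interior ((inv \<phi> \<circ> G) ` \<Sigma>) \<noteq> {}" for S
  proof -
    obtain y where y: "y \<in> S" "y \<in> interior ((inv \<phi> \<circ> G) ` \<Sigma>)"
      using S(2) by blast
    have "interior ((inv \<phi> \<circ> G) ` \<Sigma>) = inv \<phi> ` interior (G ` \<Sigma>)"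
      unfolding image_comp[symmetric] by (rule isometry_interior_image[OF inv_\<phi>])
    then have \<phi>y: "\<phi> y \<in> interior (G ` \<Sigma>)"
      using y(2) isometry_inv_cancel[OF \<phi>] by auto
    then have "\<phi> y \<in> G ` \<Sigma>"
      using interior_subset by blast
    then obtain a b where "a \<in> \<Sigma>" "b \<in> \<Sigma>" "\<phi> y = G a" "\<phi> 0 = G b"
      using \<phi>0 by blast
    then have "dist (\<phi> y) (\<phi> 0) \<le> 2 * (\<xi> ^ m * D)"
      using G dist_le[of a "\<xi> ^ m * D" b] scaled_norm by (simp add: isometry_def \<Sigma>_def)
    then have "norm y \<le> 2 * (\<xi> ^ m * D) + 1"
      using \<phi> by (simp add: isometry_def)
    then have "S \<subseteq> cball 0 r"
      using inK S(1) y(1) by blast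
    then obtain l h where lh: "(l, h) \<in> patch M i0" "\<phi> ` S = h ` T l"
      using in_patch S(1) by blast
    then obtain j' g' f where j': "(j', g') \<in> patch k i0" "(l, f) \<in> patch m j'" "h = dilate (\<xi> ^ m) g' \<circ> f"
      unfolding M mem_patch_add_iff by blast
    \<comment> \<open>\<open>\<phi> y\<close> is interior to the first supertile and belongs to the
      second, so the two coincide.\<close>
    have "(j, g) = (j', g')"
    proof (rule ccontr)
      assume "(j, g) \<noteq> (j', g')"
      then have "interior (G ` \<Sigma>) \<inter> dilate (\<xi> ^ m) g' ` ((*\<^sub>R) (\<xi> ^ m) ` T j') = {}"
        unfolding G_def \<Sigma>_def by (rule supertile_nonoverlap[OF j(1) j'(1)])
      moreover have "\<phi> y \<in> dilate (\<xi> ^ m) g' ` ((*\<^sub>R) (\<xi> ^ m) ` T j')"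
      proof -
        have "\<phi> y \<in> \<phi> ` S"
          using y(1) by (rule imageI)
        also have "\<dots> = dilate (\<xi> ^ m) g' ` f ` T l"
          by (simp add: lh(2) j'(3) image_comp)
        also have "\<dots> \<subseteq> dilate (\<xi> ^ m) g' ` ((*\<^sub>R) (\<xi> ^ m) ` T j')"
          by (intro image_mono patch_subset j')
        finally show ?thesis .
      qed
      ultimately show False
        using \<phi>y by blast
    qed
    then have "\<phi> ` S = G ` f ` T l" "(l, f) \<in> patch m j"
      using lh(2) j' by (simp_all add: G_def image_comp)
    moreover have "S = inv \<phi> ` \<phi> ` S"
      by (simp add: image_image isometry_inv_cancel[OF \<phi>])
    ultimately have "S = inv \<phi> ` G ` f ` T l" "(l, f) \<in> patch m j"
      by simp_all
    then show ?thesis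
      unfolding image_comp[symmetric] by blast
  qed
  then show ?thesis
    using that[OF isometry_comp[OF inv_\<phi> G]] unfolding \<Sigma>_def by blast
qed

subsection \<open>Heights over facets\<close>

text \<open>\<open>D i\<close> holds the marked points of \<open>T i\<close>: its vertices for claim
  (b), and for claim (a) all points that the choice function can prescribe in it.\<close>

locale decorated_substitution = polygonal_substitution T \<zeta> H
  for T :: "'n::finite \<Rightarrow> 'a::euclidean_space set" and \<zeta> :: real and H :: "'n \<Rightarrow> ('n, 'a) copy set" +
  fixes D :: "'n \<Rightarrow> 'a set"
  assumes finite_D: "finite (D i)" and D_subset: "D i \<subseteq> T i"
begin

definition decoration :: "('n, 'a) copy set \<Rightarrow> 'a set" where
  "decoration Q = (\<Union>(j, f)\<in>Q. f ` D j)"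

text \<open>The hyperplane scales with the supertile, but the threshold 1 does not. For a supporting
  hyperplane heights are nonnegative, so \<open>{..1}\<close> keeps those in [0, 1].\<close>

definition low_heights :: "nat \<Rightarrow> 'n \<times> 'a \<times> real \<Rightarrow> real set" where
  "low_heights m = (\<lambda>(j, u, b). (\<lambda>y. u \<bullet> y - \<xi> ^ m * b) ` decoration (patch m j) \<inter> {..1})"

definition facets :: "('n \<times> 'a \<times> real) set" where
  "facets = {(j, u, b). facet_data (T j) u b}"

lemma finite_facets: "finite facets"
proof -
  have "facets \<subseteq> (\<Union>j. {j} \<times> {(u, b). facet_data (T j) u b})"
    by (auto simp: facets_def)
  then show ?thesis
    by (rule finite_subset) (intro finite_UN_I finite_cartesian_product finite_facet_data polytope_T interior_T, auto)
qed

lemma finite_low_heights: "finite (low_heights m c)"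
proof -
  have "finite (decoration (patch m j))" for j
    unfolding decoration_def case_prod_unfold
    by (intro finite_UN_I finite_patch finite_imageI finite_D)
  then show ?thesis
    by (simp add: low_heights_def case_prod_unfold)
qed

text \<open>In the coordinates of a piece at level \<open>m\<close>, the translation and the offset
  both carry the factor \<open>\<xi> ^ Suc m\<close>. Their difference is therefore
  \<open>\<xi> ^ m\<close> times a number \<open>b'\<close> that does not depend on
  \<open>m\<close>, and the linear part only rotates or reflects the normal.\<close>

lemma supporting_pullback:
  assumes u: "norm u = 1" "\<And>x. x \<in> T i \<Longrightarrow> b \<le> u \<bullet> x" and f: "(j, f) \<in> H i"
  obtains u' b' where "norm u' = 1" "\<And>x. x \<in> T j \<Longrightarrow> b' \<le> u' \<bullet> x"
    "\<And>m x. u \<bullet> dilate (\<xi> ^ Suc m) f x - \<xi> ^ Suc m * b = u' \<bullet> x - \<xi> ^ m * b'"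
proof -
  obtain A t where A: "orthogonal_transformation A" "f = (\<lambda>x. t + A x)"
    by (rule isometry_affine[OF isometry_H[OF f]])
  obtain u' where u': "A u' = u"
    using orthogonal_transformation_surj[OF A(1)] by (metis surj_def)
  have inner: "u \<bullet> A x = u' \<bullet> x" for x
    using A(1) u' by (auto simp: orthogonal_transformation_def)
  define b' where "b' = \<xi> * (b - u \<bullet> t)"
  have dil: "dilate c f x = c *\<^sub>R t + A x" if "c \<noteq> 0" for c x
    using that by (simp add: dilate_def A(2) scaleR_add_right
        orthogonal_transformation_scaleR[OF A(1)])
  have heights: "u \<bullet> dilate (\<xi> ^ Suc m) f x - \<xi> ^ Suc m * b = u' \<bullet> x - \<xi> ^ m * b'" for m x
  proof -
    have "\<xi> ^ Suc m \<noteq> 0"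
      using xi by simp
    then show ?thesis
      by (subst dil) (simp_all add: inner_add_right inner b'_def algebra_simps)
  qed
  have "b' \<le> u' \<bullet> x" if "x \<in> T j" for x
  proof -
    have "f (\<zeta> *\<^sub>R x) \<in> T i"
      using H_subset[OF f] that by blast
    then have "b \<le> u \<bullet> f (\<zeta> *\<^sub>R x)"
      by (rule u(2))
    also have "\<dots> = u \<bullet> t + \<zeta> * (u' \<bullet> x)"
      by (simp add: A(2) orthogonal_transformation_scaleR[OF A(1)] inner_add_right inner)
    finally show ?thesis
      using zeta by (simp add: b'_def \<xi>_def field_simps)
  qed
  moreover have "norm u' = 1"
    using u(1) u' orthogonal_transformation_norm[OF A(1), of u'] by simp
  ultimately show ?thesis
    using that heights by blast
qed

text \<open>Seen from a facet, the pieces of a supertile of level \<open>m + 1\<close> sit in finitely many positions,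
  independent of \<open>m\<close>.\<close>

lemma low_heights_Suc:
  obtains Z where "finite Z"
    "\<And>j u b. (j, u, b) \<in> Z \<Longrightarrow> norm u = 1 \<and> (\<forall>x\<in>T j. b \<le> u \<bullet> x)"
    "\<And>m c. c \<in> facets \<Longrightarrow> low_heights (Suc m) c \<subseteq> (\<Union>c'\<in>Z. low_heights m c')"
proof -
  define good where "good = (\<lambda>u b j f u' b'. norm u' = 1 \<and> (\<forall>x\<in>T j. b' \<le> u' \<bullet> x) \<and>
    (\<forall>m x. u \<bullet> dilate (\<xi> ^ Suc m) f x - \<xi> ^ Suc m * b = u' \<bullet> x - \<xi> ^ m * b'))"
  define X where "X = facets \<times> (\<Union>i. H i)"
  \<comment> \<open>One pullback is chosen for each facet and piece, so \<open>Z\<close> is finite;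
    since \<open>good\<close> quantifies over \<open>m\<close>, the same \<open>Z\<close> serves all
    levels.\<close>
  define Z where "Z = {(j, p). \<exists>i u b f. ((i, u, b), (j, f)) \<in> X \<and> (j, f) \<in> H i \<and>
     p = (SOME p. good u b j f (fst p) (snd p))}"
  have some: "good u b j f (fst (SOME p. good u b j f (fst p) (snd p)))
      (snd (SOME p. good u b j f (fst p) (snd p)))"
    if fac: "(i, u, b) \<in> facets" and f: "(j, f) \<in> H i" for i u b j f
  proof -
    have "norm u = 1" "\<And>x. x \<in> T i \<Longrightarrow> b \<le> u \<bullet> x"
      using fac by (auto simp: facets_def facet_data_def)
    then obtain u' b' where "good u b j f u' b'"
      using supporting_pullback[OF _ _ f, of u b] unfolding good_def by metis
    then have "good u b j f (fst (u', b')) (snd (u', b'))"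
      by simp
    then show ?thesis
      by (rule someI)
  qed
  have "Z \<subseteq> (\<lambda>((i, u, b), (j, f)). (j, SOME p. good u b j f (fst p) (snd p))) ` X"
    by (force simp: Z_def)
  moreover have "finite X"
    by (simp add: X_def finite_facets finite_H)
  ultimately have "finite Z"
    by (meson finite_imageI finite_subset)
  moreover have "norm u' = 1 \<and> (\<forall>x\<in>T j. b' \<le> u' \<bullet> x)" if jZ: "(j, u', b') \<in> Z" for j u' b'
  proof -
    obtain i u b f where *: "(i, u, b) \<in> facets" "(j, f) \<in> H i"
        "(u', b') = (SOME p. good u b j f (fst p) (snd p))"
      using jZ by (auto simp: Z_def X_def)
    then show ?thesis
      using some[OF *(1,2)] by (simp flip: *(3)) (simp add: good_def)
  qed
  moreover have "low_heights (Suc m) c \<subseteq> (\<Union>c'\<in>Z. low_heights m c')" if c: "c \<in> facets" for m c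
  proof
    fix s assume s: "s \<in> low_heights (Suc m) c"
    obtain i u b where [simp]: "c = (i, u, b)"
      by (cases c)
    obtain l h y where y: "(l, h) \<in> patch (Suc m) i" "y \<in> D l"
        "s = u \<bullet> h y - \<xi> ^ Suc m * b" "s \<le> 1"
      using s by (auto simp: low_heights_def decoration_def)
    then obtain j f f' where f: "(j, f) \<in> H i" "(l, f') \<in> patch m j" "h = dilate (\<xi> ^ Suc m) f \<circ> f'"
      unfolding mem_patch_Suc_iff by blast
    obtain u' b' where ub: "(u', b') = (SOME p. good u b j f (fst p) (snd p))"
      by (metis surj_pair)
    have cf: "(i, u, b) \<in> facets"
      using c by simp
    have "((i, u, b), (j, f)) \<in> X"
      using cf f(1) by (auto simp: X_def)
    then have Z: "(j, u', b') \<in> Z"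
      using f(1) ub by (auto simp: Z_def)
    have "good u b j f u' b'"
      using some[OF cf f(1)] by (simp flip: ub)
    then have "s = u' \<bullet> f' y - \<xi> ^ m * b'"
      unfolding y(3) f(3) comp_def good_def by blast
    moreover have "f' y \<in> decoration (patch m j)"
      using y(2) f(2) by (force simp: decoration_def)
    ultimately have "s \<in> low_heights m (j, u', b')"
      using y(4) by (simp add: low_heights_def)
    then show "s \<in> (\<Union>c'\<in>Z. low_heights m c')"
      using Z by blast
  qed
  ultimately show ?thesis
    by (rule that)
qed

text \<open>The tiles responsible for these heights stay within bounded distance of two orthogonal
  hyperplanes, which leaves \<open>DIM('a) - 2\<close> free directions.\<close>

lemma card_low_heights_non_facet:
  assumes u: "norm u = 1" "\<And>x. x \<in> T j \<Longrightarrow> b \<le> u \<bullet> x" and not_facet: "(j, u, b) \<notin> facets"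
  obtains K where "K \<ge> 0" "\<And>m. real (card (low_heights m (j, u, b))) \<le> K * (\<xi> ^ m) ^ (DIM('a) - 2)"
proof -
  have nf: "\<not> facet_data (T j) u b"
    using not_facet by (simp add: facets_def)
  obtain w \<beta> C where w: "norm w = 1" "u \<bullet> w = 0" "C \<ge> 0"
    "\<forall>x\<in>T j. \<bar>w \<bullet> x - \<beta>\<bar> \<le> C * (u \<bullet> x - b)"
    by (rule lower_dimensional_contact[OF polytope_T u nf dim])
  obtain B where B: "u \<in> B" "w \<in> B" "pairwise orthogonal B" "\<And>b. b \<in> B \<Longrightarrow> norm b = 1"
    "card B = DIM('a)" "span B = UNIV"
    using orthonormal_basis_pair[OF u(1) w(1,2)] by metis
  have finB: "finite B"
    using B(5) by (metis DIM_positive card.infinite less_irrefl)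
  have "u \<noteq> w"
    using u(1) w(2) by (auto simp: norm_eq_1)
  obtain R where R: "R > 0" "\<And>i x. x \<in> T i \<Longrightarrow> norm x \<le> R"
    using tile_bound by blast
  obtain z r where r: "r > 0" "\<forall>i. ball (z i) r \<subseteq> T i"
    by (rule tile_inball)
  have zT: "z i \<in> T i" for i
    using r by (meson centre_in_ball subsetD)
  define N where "N = Max (range (\<lambda>i. card (D i)))"
  have N: "card (D i) \<le> N" for i
    unfolding N_def by (intro Max_ge) auto
  define d where "d = real DIM('a)"
  \<comment> \<open>The first two factors count grid cells in the directions \<open>u\<close> and
    \<open>w\<close>, where the extent is bounded; the last one treats each of the other directions,
    of extent \<open>\<xi> ^ m * R\<close>.\<close>
  define K0 where "K0 = (2 * d * (1 + 2 * R) / r + 1) * (2 * d * (C * (1 + 2 * R)) / r + 1) *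
    (2 * d * R / r + 1) ^ (DIM('a) - 2)"
  have "real (card (low_heights m (j, u, b))) \<le> N * K0 * (\<xi> ^ m) ^ (DIM('a) - 2)" for m
  proof -
    define P where "P = {(l, h) \<in> patch m j. \<exists>y\<in>D l. u \<bullet> h y - \<xi> ^ m * b \<le> 1}"
    define ctr where "ctr = (\<lambda>(l, h). h (z l) :: 'a)"
    have Psub: "P \<subseteq> patch m j"
      by (auto simp: P_def)
    have finP: "finite P"
      using Psub finite_patch by (rule finite_subset)
    have sep: "dist (ctr p) (ctr q) \<ge> r" if "p \<in> P" "q \<in> P" "p \<noteq> q" for p q
      using patch_centres_separated[OF spec[OF r(2)] r(1), of "fst p" "snd p" m j "fst q" "snd q"] that Psub
      by (auto simp: ctr_def case_prod_unfold)
    then have inj: "inj_on ctr P"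
      using r(1) by (force intro!: inj_onI)
    define c where "c = (\<lambda>v. if v = u then \<xi> ^ m * b else if v = w then \<xi> ^ m * \<beta> else 0)"
    \<comment> \<open>A centre is within \<open>2 * R\<close> of a marked point of height at most 1,
      hence has height at most \<open>1 + 2 * R\<close>; the contact estimate turns this into a
      bound in direction \<open>w\<close>, with the same \<open>C\<close> at every scale because it
      is homogeneous.\<close>
    define L where "L = (\<lambda>v. if v = u then 1 + 2 * R else if v = w then C * (1 + 2 * R) else \<xi> ^ m * R)"
    have box: "\<bar>v \<bullet> q - c v\<bar> \<le> L v" if q: "q \<in> ctr ` P" and v: "v \<in> B" for q v
    proof -
      obtain l h y where lh: "(l, h) \<in> patch m j" "q = h (z l)" "y \<in> D l" "u \<bullet> h y - \<xi> ^ m * b \<le> 1"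
        using q by (auto simp: P_def ctr_def)
      have "q \<in> (*\<^sub>R) (\<xi> ^ m) ` T j"
        using patch_subset[OF lh(1)] zT lh(2) by blast
      then obtain x where x: "x \<in> T j" "q = \<xi> ^ m *\<^sub>R x"
        by blast
      have "y \<in> T l"
        using lh(3) D_subset by blast
      then have "norm (z l - y) \<le> 2 * R"
        using norm_triangle_ineq4[of "z l" y] R(2)[OF zT, of l] R(2)[of y l] by linarith
      then have "norm (q - h y) \<le> 2 * R"
        using isometry_patch[OF lh(1)] lh(2) by (simp add: isometry_def dist_norm)
      then have "u \<bullet> q - u \<bullet> h y \<le> 2 * R"
        using norm_cauchy_schwarz[of u "q - h y"] u(1) by (simp add: inner_diff_right)
      then have hq: "u \<bullet> q - \<xi> ^ m * b \<le> 1 + 2 * R"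
        using lh(4) by linarith
      have uq: "u \<bullet> q - \<xi> ^ m * b = \<xi> ^ m * (u \<bullet> x - b)"
        by (simp add: x right_diff_distrib)
      have wq: "\<bar>w \<bullet> q - \<xi> ^ m * \<beta>\<bar> = \<xi> ^ m * \<bar>w \<bullet> x - \<beta>\<bar>"
        using abs_mult_pos[of "\<xi> ^ m" "w \<bullet> x - \<beta>"] xi_pow_pos[of m]
        by (simp add: x right_diff_distrib mult.commute)
      also have "\<dots> \<le> \<xi> ^ m * (C * (u \<bullet> x - b))"
        using bspec[OF w(4) x(1)] by (intro mult_left_mono) (auto intro: less_imp_le)
      also have "\<dots> = C * (u \<bullet> q - \<xi> ^ m * b)"
        by (simp add: uq)
      also have "\<dots> \<le> C * (1 + 2 * R)"
        using hq w(3) by (rule mult_left_mono)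
      finally have "\<bar>w \<bullet> q - \<xi> ^ m * \<beta>\<bar> \<le> C * (1 + 2 * R)" .
      moreover have "0 \<le> u \<bullet> q - \<xi> ^ m * b"
        unfolding uq using u(2)[OF x(1)] by (intro mult_nonneg_nonneg) (auto intro: less_imp_le)
      moreover have "\<bar>v \<bullet> q\<bar> \<le> \<xi> ^ m * R"
      proof -
        have "\<bar>v \<bullet> q\<bar> \<le> norm v * norm q"
          by (rule Cauchy_Schwarz_ineq2)
        also have "\<dots> = \<xi> ^ m * norm x"
          using B(4)[OF v] xi by (simp add: x)
        also have "\<dots> \<le> \<xi> ^ m * R"
          using R(2)[OF x(1)] by (intro mult_left_mono) (auto intro: less_imp_le)
        finally show ?thesis .
      qed
      ultimately show ?thesis
        using hq by (auto simp: c_def L_def)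
    qed
    have L: "L v \<ge> 0" for v
      using R(1) w(3) xi by (simp add: L_def)
    have sep': "dist p q \<ge> r" if "p \<in> ctr ` P" "q \<in> ctr ` P" "p \<noteq> q" for p q
      using that sep by blast
    have "real (card P) = real (card (ctr ` P))"
      by (simp add: card_image[OF inj])
    also have "\<dots> \<le> (\<Prod>v\<in>B. 2 * d * L v / r + 1)"
      unfolding d_def by (rule separated_card_bound(2)[OF B(3,4,5,6) r(1) sep' L box])
    also have "\<dots> = (2 * d * L u / r + 1) * ((2 * d * L w / r + 1) *
        (\<Prod>v\<in>B - {u} - {w}. 2 * d * L v / r + 1))"
      using finB B(1,2) \<open>u \<noteq> w\<close> by (subst prod.remove[of B u], simp, simp, subst prod.remove[of "B - {u}" w]) auto
    also have "(\<Prod>v\<in>B - {u} - {w}. 2 * d * L v / r + 1) = (\<Prod>v\<in>B - {u} - {w}. 2 * d * (\<xi> ^ m * R) / r + 1)"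
      by (intro prod.cong) (auto simp: L_def)
    also have "\<dots> = (2 * d * (\<xi> ^ m * R) / r + 1) ^ (DIM('a) - 2)"
      using finB B(1,2,5) \<open>u \<noteq> w\<close> by (simp add: card_Diff_singleton numeral_2_eq_2)
    also have "(2 * d * L u / r + 1) * ((2 * d * L w / r + 1) * \<dots>) \<le> K0 * (\<xi> ^ m) ^ (DIM('a) - 2)"
    proof -
      have "1 \<le> \<xi> ^ m"
        using xi by (simp add: one_le_power)
      moreover have "(2 * d * R / r + 1) * \<xi> ^ m = 2 * d * (\<xi> ^ m * R) / r + \<xi> ^ m"
        by (simp add: distrib_right)
      ultimately have "2 * d * (\<xi> ^ m * R) / r + 1 \<le> (2 * d * R / r + 1) * \<xi> ^ m"
        by linarith
      moreover have "0 \<le> 2 * d * (\<xi> ^ m * R) / r + 1"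
        using R(1) r(1) by (simp add: d_def less_imp_le)
      ultimately have "(2 * d * (\<xi> ^ m * R) / r + 1) ^ (DIM('a) - 2)
          \<le> ((2 * d * R / r + 1) * \<xi> ^ m) ^ (DIM('a) - 2)"
        by (rule power_mono)
      also have "\<dots> = (2 * d * R / r + 1) ^ (DIM('a) - 2) * (\<xi> ^ m) ^ (DIM('a) - 2)"
        by (rule power_mult_distrib)
      finally have "(2 * d * L u / r + 1) * (2 * d * L w / r + 1) * (2 * d * (\<xi> ^ m * R) / r + 1) ^ (DIM('a) - 2)
        \<le> (2 * d * L u / r + 1) * (2 * d * L w / r + 1) *
          ((2 * d * R / r + 1) ^ (DIM('a) - 2) * (\<xi> ^ m) ^ (DIM('a) - 2))"
        using L r(1) by (intro mult_left_mono) (auto simp: d_def)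
      moreover have "L u = 1 + 2 * R" "L w = C * (1 + 2 * R)"
        using \<open>u \<noteq> w\<close> by (auto simp: L_def)
      ultimately show ?thesis
        by (simp only: K0_def mult.assoc)
    qed
    finally have cardP: "real (card P) \<le> K0 * (\<xi> ^ m) ^ (DIM('a) - 2)" .
    have "low_heights m (j, u, b) \<subseteq> (\<Union>p\<in>P. (\<lambda>y. u \<bullet> snd p y - \<xi> ^ m * b) ` D (fst p))"
      by (force simp: low_heights_def decoration_def P_def)
    then have "card (low_heights m (j, u, b)) \<le> card (\<Union>p\<in>P. (\<lambda>y. u \<bullet> snd p y - \<xi> ^ m * b) ` D (fst p))"
      by (rule card_mono[rotated]) (simp add: finP finite_D)
    also have "\<dots> \<le> (\<Sum>p\<in>P. card ((\<lambda>y. u \<bullet> snd p y - \<xi> ^ m * b) ` D (fst p)))"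
      by (rule card_UN_le[OF finP])
    also have "\<dots> \<le> (\<Sum>p\<in>P. N)"
      by (intro sum_mono order.trans[OF card_image_le[OF finite_D] N])
    also have "\<dots> = card P * N"
      by simp
    finally have "real (card (low_heights m (j, u, b))) \<le> real (card P) * N"
      by (metis of_nat_le_iff of_nat_mult)
    also have "\<dots> \<le> K0 * (\<xi> ^ m) ^ (DIM('a) - 2) * N"
      using cardP by (rule mult_right_mono) simp
    finally show ?thesis
      by (simp add: algebra_simps)
  qed
  moreover have "N * K0 \<ge> 0"
    using R(1) r(1) w(3) by (auto simp: K0_def d_def)
  ultimately show ?thesis
    by (rule that[rotated])
qed

section \<open>Counting all heights, and an empty convex set in each supertile\<close>

definition facet_heights :: "nat \<Rightarrow> real set" where
  "facet_heights m = (\<Union>c\<in>facets. low_heights m c)"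

lemma finite_facet_heights: "finite (facet_heights m)"
  unfolding facet_heights_def by (intro finite_UN_I finite_facets finite_low_heights)

text \<open>Members of \<open>Z\<close> that are facets add nothing beyond the previous level, and
  each of the finitely many others costs \<open>O((\<xi> ^ m) ^ (DIM('a) - 2))\<close>. These costs
  do not decrease with \<open>m\<close>, so summing them gives the factor linear in
  \<open>m\<close>.\<close>

lemma card_facet_heights:
  obtains K where "K \<ge> 0" "\<And>m. real (card (facet_heights m)) \<le> K * (real m + 1) * (\<xi> ^ m) ^ (DIM('a) - 2)"
proof -
  obtain Z where Z: "finite Z"
    "\<And>j u b. (j, u, b) \<in> Z \<Longrightarrow> norm u = 1 \<and> (\<forall>x\<in>T j. b \<le> u \<bullet> x)"
    "\<And>m c. c \<in> facets \<Longrightarrow> low_heights (Suc m) c \<subseteq> (\<Union>c'\<in>Z. low_heights m c')"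
    using low_heights_Suc by metis
  have "\<exists>K\<ge>0. \<forall>m. real (card (low_heights m c)) \<le> K * (\<xi> ^ m) ^ (DIM('a) - 2)" if "c \<in> Z - facets" for c
  proof -
    obtain j u b where "c = (j, u, b)"
      by (cases c)
    then show ?thesis
      using that Z(2) card_low_heights_non_facet[of u j b] by (metis DiffD1 DiffD2)
  qed
  then obtain k where k: "\<And>c. c \<in> Z - facets \<Longrightarrow> k c \<ge> 0"
    "\<And>c m. c \<in> Z - facets \<Longrightarrow> real (card (low_heights m c)) \<le> k c * (\<xi> ^ m) ^ (DIM('a) - 2)"
    by metis
  define K1 where "K1 = sum k (Z - facets)"
  define K where "K = card (facet_heights 0) + K1"
  have K1: "K1 \<ge> 0"
    unfolding K1_def by (rule sum_nonneg) (rule k)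
  have step: "real (card (facet_heights (Suc m))) \<le> card (facet_heights m) + K1 * (\<xi> ^ m) ^ (DIM('a) - 2)" for m
  proof -
    have "facet_heights (Suc m) \<subseteq> (\<Union>c'\<in>Z. low_heights m c')"
      unfolding facet_heights_def by (intro UN_least Z(3))
    also have "\<dots> \<subseteq> facet_heights m \<union> (\<Union>c'\<in>Z - facets. low_heights m c')"
      by (auto simp: facet_heights_def)
    finally have "card (facet_heights (Suc m)) \<le> card (facet_heights m \<union> (\<Union>c'\<in>Z - facets. low_heights m c'))"
      by (rule card_mono[rotated]) (simp add: finite_facet_heights Z(1) finite_low_heights)
    also have "\<dots> \<le> card (facet_heights m) + card (\<Union>c'\<in>Z - facets. low_heights m c')"
      by (rule card_Un_le)
    also have "card (\<Union>c'\<in>Z - facets. low_heights m c') \<le> (\<Sum>c'\<in>Z - facets. card (low_heights m c'))"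
      by (rule card_UN_le) (simp add: Z(1))
    finally have "real (card (facet_heights (Suc m)))
        \<le> card (facet_heights m) + (\<Sum>c'\<in>Z - facets. real (card (low_heights m c')))"
      by (simp flip: of_nat_sum of_nat_add)
    also have "(\<Sum>c'\<in>Z - facets. real (card (low_heights m c')))
        \<le> (\<Sum>c'\<in>Z - facets. k c' * (\<xi> ^ m) ^ (DIM('a) - 2))"
      by (intro sum_mono k)
    finally show ?thesis
      by (simp add: K1_def sum_distrib_right)
  qed
  have "real (card (facet_heights m)) \<le> K * (real m + 1) * (\<xi> ^ m) ^ (DIM('a) - 2)" for m
  proof (induction m)
    case 0
    then show ?case
      using K1 by (simp add: K_def)
  next
    case (Suc m)
    let ?p = "\<lambda>m. (\<xi> ^ m) ^ (DIM('a) - 2)"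
    have mono: "?p m \<le> ?p (Suc m)" and pos: "0 \<le> ?p m"
      using xi by (auto intro!: power_mono)
    have "real (card (facet_heights (Suc m))) \<le> K * (real m + 1) * ?p m + K1 * ?p m"
      using step[of m] Suc.IH by linarith
    also have "\<dots> \<le> K * (real m + 1) * ?p m + K * ?p m"
      using pos by (intro add_left_mono mult_right_mono) (simp_all add: K_def)
    also have "\<dots> = K * (real (Suc m) + 1) * ?p m"
      by (simp add: algebra_simps)
    also have "\<dots> \<le> K * (real (Suc m) + 1) * ?p (Suc m)"
      using mono K1 by (intro mult_left_mono) (simp_all add: K_def)
    finally show ?case .
  qed
  moreover have "K \<ge> 0"
    using K1 by (simp add: K_def)
  ultimately show ?thesis
    by (rule that[rotated])
qed

text \<open>A single \<open>m\<close> has to serve all \<open>j\<close>, since the type of the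
  supertile found in a tiling cannot be prescribed; the volume bound for every \<open>\<Psi>\<close>
  does the same for its position.\<close>

lemma empty_convex_in_supertile:
  obtains m where "\<forall>j. \<exists>C. convex C \<and> C \<subseteq> interior ((*\<^sub>R) (\<xi> ^ m) ` T j) \<and>
    C \<inter> decoration (patch m j) = {} \<and> (\<forall>\<Psi>. isometry \<Psi> \<longrightarrow> measure lebesgue (\<Psi> ` C) \<ge> 1)"
proof -
  have "\<exists>u b \<kappa> R. facet_data (T j) u b \<and> \<kappa> > 0 \<and> (\<forall>r (N::nat) (k::nat). r \<ge> R \<longrightarrow> k < N \<longrightarrow>
       (\<exists>C. convex C \<and> C \<subseteq> interior ((*\<^sub>R) r ` T j) \<and>
         (\<forall>y\<in>C. real k / real N < u \<bullet> y - r * b \<and> u \<bullet> y - r * b \<le> (real k + 1) / real N) \<and>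
         (\<forall>\<Psi>. isometry \<Psi> \<longrightarrow> \<kappa> * r ^ (DIM('a) - 1) / N \<le> measure lebesgue (\<Psi> ` C))))" for j
  proof -
    obtain u b where fd: "facet_data (T j) u b"
      using facet_data_exists[OF polytope_T aff_dim_T] by blast
    obtain \<kappa> R where "\<kappa> > 0" "R > 0" "\<And>r (N::nat) (k::nat). r \<ge> R \<Longrightarrow> k < N \<Longrightarrow>
       (\<exists>C. convex C \<and> C \<subseteq> interior ((*\<^sub>R) r ` T j) \<and>
         (\<forall>y\<in>C. real k / real N < u \<bullet> y - r * b \<and> u \<bullet> y - r * b \<le> (real k + 1) / real N) \<and>
         (\<forall>\<Psi>. isometry \<Psi> \<longrightarrow> \<kappa> * r ^ (DIM('a) - 1) / N \<le> measure lebesgue (\<Psi> ` C)))"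
      by (rule facet_slab[OF convex_T bounded_T interior_T fd]) blast
    then show ?thesis
      using fd by blast
  qed
  then obtain u b \<kappa> R where fd: "\<And>j. facet_data (T j) (u j) (b j)" and \<kappa>: "\<And>j. \<kappa> j > 0"
    and slab: "\<And>j r (N::nat) (k::nat). r \<ge> R j \<Longrightarrow> k < N \<Longrightarrow>
       \<exists>C. convex C \<and> C \<subseteq> interior ((*\<^sub>R) r ` T j) \<and>
         (\<forall>y\<in>C. real k / real N < u j \<bullet> y - r * b j \<and> u j \<bullet> y - r * b j \<le> (real k + 1) / real N) \<and>
         (\<forall>\<Psi>. isometry \<Psi> \<longrightarrow> \<kappa> j * r ^ (DIM('a) - 1) / N \<le> measure lebesgue (\<Psi> ` C))"
    by metis
  obtain K where K: "K \<ge> 0"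
    "\<And>m. real (card (facet_heights m)) \<le> K * (real m + 1) * (\<xi> ^ m) ^ (DIM('a) - 2)"
    using card_facet_heights by blast
  have "(\<lambda>m. real m / \<xi> ^ m) \<longlonglongrightarrow> 0"
    using lim_n_over_pown[of \<xi>] xi by simp
  moreover have "(\<lambda>m. 1 / \<xi> ^ m) \<longlonglongrightarrow> 0"
    using LIMSEQ_inverse_realpow_zero[OF xi] by (simp add: field_simps)
  ultimately have "(\<lambda>m. (K + 1) * (real m / \<xi> ^ m + 1 / \<xi> ^ m)) \<longlonglongrightarrow> (K + 1) * (0 + 0)"
    by (intro tendsto_intros)
  then have lim: "(\<lambda>m. (K + 1) * (real m + 1) / \<xi> ^ m) \<longlonglongrightarrow> 0"
    by (simp flip: add_divide_distrib)
  have "\<forall>\<^sub>F m in sequentially. \<forall>j. (K + 1) * (real m + 1) / \<xi> ^ m < \<kappa> j"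
    by (intro eventually_all_finite order_tendstoD(2)[OF lim] \<kappa>)
  moreover have "\<forall>\<^sub>F m in sequentially. \<forall>j. R j \<le> \<xi> ^ m"
    using filterlim_realpow_sequentially_gt1[of \<xi>] xi
    by (intro eventually_all_finite) (auto simp: filterlim_at_infinity_conv_norm_at_top filterlim_at_top)
  ultimately have "\<forall>\<^sub>F m in sequentially. (\<forall>j. (K + 1) * (real m + 1) / \<xi> ^ m < \<kappa> j) \<and> (\<forall>j. R j \<le> \<xi> ^ m)"
    by (rule eventually_conj)
  then obtain m where m: "\<And>j. (K + 1) * (real m + 1) / \<xi> ^ m < \<kappa> j" "\<And>j. R j \<le> \<xi> ^ m"
    by (auto simp: eventually_sequentially)
  show ?thesis
  proof (rule that, rule allI)
    fix j
    define N where "N = Suc (card (facet_heights m))"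
    obtain k where k: "k < N" "\<And>x. x \<in> facet_heights m \<Longrightarrow> \<not> (real k / N < x \<and> x \<le> (real k + 1) / N)"
      using ex_interval_avoiding[OF finite_facet_heights, of m N] by (auto simp: N_def)
    obtain C where C: "convex C" "C \<subseteq> interior ((*\<^sub>R) (\<xi> ^ m) ` T j)"
      "\<And>y. y \<in> C \<Longrightarrow> real k / N < u j \<bullet> y - \<xi> ^ m * b j \<and> u j \<bullet> y - \<xi> ^ m * b j \<le> (real k + 1) / N"
      "\<And>\<Psi>. isometry \<Psi> \<Longrightarrow> \<kappa> j * (\<xi> ^ m) ^ (DIM('a) - 1) / N \<le> measure lebesgue (\<Psi> ` C)"
      using slab[OF m(2) k(1)] by blast
    have "C \<inter> decoration (patch m j) = {}"
    proof (rule ccontr)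
      assume "C \<inter> decoration (patch m j) \<noteq> {}"
      then obtain y where y: "y \<in> C" "y \<in> decoration (patch m j)"
        by blast
      \<comment> \<open>The slice stays below height 1, so a marked point in it would have its
        height recorded.\<close>
      have "(real k + 1) / N \<le> 1"
        using k(1) by (simp add: divide_simps)
      then have "u j \<bullet> y - \<xi> ^ m * b j \<in> low_heights m (j, u j, b j)"
        using C(3)[OF y(1)] y(2) by (auto simp: low_heights_def)
      moreover have "(j, u j, b j) \<in> facets"
        using fd by (simp add: facets_def)
      ultimately have "u j \<bullet> y - \<xi> ^ m * b j \<in> facet_heights m"
        by (auto simp: facet_heights_def)
      then show False
        using k(2) C(3)[OF y(1)] by blast
    qed
    moreover have "\<kappa> j * (\<xi> ^ m) ^ (DIM('a) - 1) / N \<ge> 1"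
    proof -
      define p where "p = (\<xi> ^ m) ^ (DIM('a) - 2)"
      have p: "p \<ge> 1"
        using xi by (simp add: p_def)
      have "real N \<le> K * (real m + 1) * p + 1 * 1"
        using K(2)[of m] by (simp add: N_def p_def algebra_simps)
      \<comment> \<open>Absorbs the extra slice in \<open>N\<close>, at the price of
        \<open>K + 1\<close> instead of \<open>K\<close>.\<close>
      also have "1 * 1 \<le> (real m + 1) * p"
        using p by (intro mult_mono) auto
      finally have "real N \<le> (K + 1) * (real m + 1) * p"
        by (simp add: algebra_simps)
      also have "\<dots> \<le> (\<kappa> j * \<xi> ^ m) * p"
        using m(1)[of j] p by (intro mult_right_mono) (simp_all add: pos_divide_less_eq less_imp_le)
      also have "\<dots> = \<kappa> j * (\<xi> ^ m) ^ Suc (DIM('a) - 2)"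
        by (simp add: p_def)
      also have "Suc (DIM('a) - 2) = DIM('a) - 1"
        using dim by simp
      finally show ?thesis
        by (simp add: N_def pos_le_divide_eq)
    qed
    ultimately show "\<exists>C. convex C \<and> C \<subseteq> interior ((*\<^sub>R) (\<xi> ^ m) ` T j) \<and>
        C \<inter> decoration (patch m j) = {} \<and> (\<forall>\<Psi>. isometry \<Psi> \<longrightarrow> measure lebesgue (\<Psi> ` C) \<ge> 1)"
      using C by (meson order_trans)
  qed
qed

section \<open>From marked supertiles to tilings\<close>

text \<open>The condition on \<open>Y\<close> ranges over all ways to see a tile as a copy of a
  basic tile, because the supertile supplies its own \<open>l\<close> and \<open>h\<close>, which
  may differ from those that produced the point.\<close>

theorem decorated_tiling_not_danzer:
  assumes \<tau>: "\<tau> \<in> tiling_space T \<zeta> H"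
    and Y: "\<And>y. y \<in> Y \<Longrightarrow> \<exists>S\<in>\<tau>. y \<in> S \<and>
      (\<forall>\<phi> l h. isometry \<phi> \<longrightarrow> isometry h \<longrightarrow> \<phi> ` S = h ` T l \<longrightarrow> \<phi> y \<in> h ` D l)"
  shows "\<not> danzer_set Y"
proof
  assume danzer: "danzer_set Y"
  obtain m where m: "\<forall>j. \<exists>C. convex C \<and> C \<subseteq> interior ((*\<^sub>R) (\<xi> ^ m) ` T j) \<and>
    C \<inter> decoration (patch m j) = {} \<and> (\<forall>\<Psi>. isometry \<Psi> \<longrightarrow> measure lebesgue (\<Psi> ` C) \<ge> 1)"
    by (rule empty_convex_in_supertile)
  obtain j \<Psi> where \<Psi>: "isometry \<Psi>"
    and super: "\<And>S. S \<in> \<tau> \<Longrightarrow> S \<inter> interior (\<Psi> ` ((*\<^sub>R) (\<xi> ^ m) ` T j)) \<noteq> {} \<Longrightarrow>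
       \<exists>l h. (l, h) \<in> patch m j \<and> S = \<Psi> ` h ` T l"
    using supertile_in_tiling[OF \<tau>] by metis
  obtain C where C: "convex C" "C \<subseteq> interior ((*\<^sub>R) (\<xi> ^ m) ` T j)"
    "C \<inter> decoration (patch m j) = {}" "measure lebesgue (\<Psi> ` C) \<ge> 1"
    using spec[OF m, of j] \<Psi> by blast
  have "bounded C"
    using C(2) interior_subset bounded_T[of j] by (meson bounded_scaling bounded_subset)
  then have "bounded (\<Psi> ` C)"
    using \<Psi> unfolding bounded_def isometry_def by (metis imageE)
  then have "Y \<inter> \<Psi> ` C \<noteq> {}"
    by (intro danzer_set_meets danzer isometry_convex_image \<Psi> C)
  then obtain c where c: "c \<in> C" "\<Psi> c \<in> Y"
    by blast
  obtain S where S: "S \<in> \<tau>" "\<Psi> c \<in> S"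
    and dec: "\<And>\<phi> l h. isometry \<phi> \<Longrightarrow> isometry h \<Longrightarrow> \<phi> ` S = h ` T l \<Longrightarrow> \<phi> (\<Psi> c) \<in> h ` D l"
    using Y[OF c(2)] by blast
  have "\<Psi> c \<in> interior (\<Psi> ` ((*\<^sub>R) (\<xi> ^ m) ` T j))"
    using c(1) C(2) by (auto simp: isometry_interior_image[OF \<Psi>])
  then obtain l h where lh: "(l, h) \<in> patch m j" "S = \<Psi> ` h ` T l"
    using super[OF S(1)] S(2) by blast
  have "inv \<Psi> ` S = h ` T l"
    by (simp add: lh(2) image_image isometry_inv_cancel[OF \<Psi>])
  then have "inv \<Psi> (\<Psi> c) \<in> h ` D l"
    by (intro dec isometry_inv \<Psi> isometry_patch[OF lh(1)])
  then have "c \<in> decoration (patch m j)"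
    using lh(1) by (auto simp: decoration_def isometry_inv_cancel[OF \<Psi>])
  then show False
    using c(1) C(3) by blast
qed

end

theorem theorem1p1:
  fixes T :: "'n::finite \<Rightarrow> 'a::euclidean_space set"
    and \<zeta> :: real
    and H :: "'n \<Rightarrow> ('n, 'a) copy set"
  assumes "DIM('a) \<ge> 2"
    and "\<forall>i. polygonal_tile (T i)"
    and "substitution T \<zeta> H"
    and "primitive_subst H"
  shows "(\<forall>\<tau> \<in> tiling_space T \<zeta> H. \<forall>h Y.
            choice_function T h \<and> picked_points T h \<tau> Y \<and> delone_set Y \<longrightarrow> \<not> danzer_set Y)
       \<and> (\<forall>\<tau> \<in> tiling_space T \<zeta> H. \<not> danzer_set (tile_vertices \<tau>))"
proof (intro conjI ballI allI impI)
  fix \<tau> h Y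
  assume \<tau>: "\<tau> \<in> tiling_space T \<zeta> H"
    and Y: "choice_function T h \<and> picked_points T h \<tau> Y \<and> delone_set Y"
  have poly: "polytope (T i)" for i
    using assms(2) by (simp add: polygonal_tile_def)
  have hT: "h i \<in> T i" for i
    using Y by (simp add: choice_function_def)
  \<comment> \<open>A tile can be congruent to several basic tiles or have symmetries, so every
    image of some \<open>h i\<close> under an isometry onto \<open>T l\<close> has to be
    marked.\<close>
  define D where "D l = (\<Union>i. {g (h i) |g. isometry g \<and> g ` T i = T l})" for l
  interpret decorated_substitution T \<zeta> H D
  proof unfold_locales
    show "finite (D i)" for i
      unfolding D_def by (intro finite_UN_I finite_isometric_images poly hT) simp
    show "D i \<subseteq> T i" for i
      using hT by (auto simp: D_def)
  qed (use assms in auto)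
  show "\<not> danzer_set Y"
  proof (rule decorated_tiling_not_danzer[OF \<tau>])
    fix y assume "y \<in> Y"
    then obtain S i g where S: "S \<in> \<tau>" "isometry g" "S = g ` T i" "y = g (h i)"
      using Y unfolding picked_points_def by blast
    have "\<phi> y \<in> k ` D l" if \<phi>: "isometry \<phi>" "isometry k" "\<phi> ` S = k ` T l" for \<phi> l k
    proof -
      \<comment> \<open>\<open>f\<close> compares the representation \<open>g\<close> used for
        picking with the given \<open>k\<close>; as an isometry of \<open>T i\<close> onto
        \<open>T l\<close> it sends \<open>h i\<close> to a marked point.\<close>
      define f where "f = inv k \<circ> \<phi> \<circ> g"
      have "isometry f"
        unfolding f_def by (intro isometry_comp isometry_inv \<phi> S)
      moreover have "f ` T i = inv k ` k ` T l"
        unfolding f_def image_comp[symmetric] S(3)[symmetric] \<phi>(3) ..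
      then have "f ` T i = T l"
        by (simp add: image_image isometry_inv_cancel[OF \<phi>(2)])
      ultimately have "f (h i) \<in> D l"
        unfolding D_def by blast
      moreover have "\<phi> y = k (f (h i))"
        by (simp add: f_def S(4) isometry_inv_cancel[OF \<phi>(2)])
      ultimately show ?thesis
        by blast
    qed
    moreover have "y \<in> S"
      unfolding S(3,4) using hT by (rule imageI)
    ultimately show "\<exists>S\<in>\<tau>. y \<in> S \<and>
        (\<forall>\<phi> l h. isometry \<phi> \<longrightarrow> isometry h \<longrightarrow> \<phi> ` S = h ` T l \<longrightarrow> \<phi> y \<in> h ` D l)"
      by (intro bexI[OF _ S(1)] conjI allI impI)
  qed
next
  fix \<tau>
  assume \<tau>: "\<tau> \<in> tiling_space T \<zeta> H"
  define D where "D l = {v. v extreme_point_of T l}" for l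
  interpret decorated_substitution T \<zeta> H D
  proof unfold_locales
    show "finite (D i)" for i
      unfolding D_def
      using assms(2) by (intro finite_polyhedron_extreme_points polytope_imp_polyhedron)
        (simp add: polygonal_tile_def)
    show "D i \<subseteq> T i" for i
      by (auto simp: D_def extreme_point_of_def)
  qed (use assms in auto)
  show "\<not> danzer_set (tile_vertices \<tau>)"
  proof (rule decorated_tiling_not_danzer[OF \<tau>])
    fix y assume "y \<in> tile_vertices \<tau>"
    then obtain S where S: "S \<in> \<tau>" "y extreme_point_of S"
      by (auto simp: tile_vertices_def)
    have "\<phi> y \<in> k ` D l" if \<phi>: "isometry \<phi>" "isometry k" "\<phi> ` S = k ` T l" for \<phi> l k
    proof -
      have "\<phi> y extreme_point_of k ` T l"
        using S(2) by (simp add: isometry_extreme_point[OF \<phi>(1)] flip: \<phi>(3))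
      moreover then obtain x where "x \<in> T l" "\<phi> y = k x"
        by (auto simp: extreme_point_of_def)
      ultimately show ?thesis
        by (simp add: isometry_extreme_point[OF \<phi>(2)] D_def)
    qed
    then show "\<exists>S\<in>\<tau>. y \<in> S \<and>
        (\<forall>\<phi> l h. isometry \<phi> \<longrightarrow> isometry h \<longrightarrow> \<phi> ` S = h ` T l \<longrightarrow> \<phi> y \<in> h ` D l)"
      using S by (auto simp: extreme_point_of_def)
  qed
qed

end
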